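(* Let $q\in[-1,1]$, let $d\ge1$, and let $(c(i,j))_{i,j=1}^d$ be a real positive definite matrix. Let $(\mathcal{A},\phi)$ be a probability space with expectation $\mathbb{E}$, with $\mathcal{A}$ generated by symmetric operators $X_1,\ldots,X_d$, and let $a^-(i),a^0(i),a^+(i)$ be the annihilation, preservation and creation operators of $X_i$. If for all $i,j\in\{1,\ldots,d\}$ \[ [a^-(i);a^+(j)]_q=c(i,j)\, I,\qquad [a^-(i);a^0(j)]_q=0,\qquad \mathbb{E}[X_i]=0, \] then $(X_1,\ldots,X_d)$ is moment equal to the vector of $q$-Gaussian random variables $(x(f_1),\ldots,x(f_d))$, where $f_1,\ldots,f_d$ are vectors of a real Hilbert space $H_0$ with $\langle f_i,f_j\rangle=c(i,j)$ for all $i,j$. Moreover, these conditions characterize random variables that are moment equal to $q$-Gaussians: conversely, if $(X_1,\ldots,X_d)$ is moment equal to such a vector $(x(f_1),\ldots,x(f_d))$, then the three conditions above hold for all $i,j\in\{1,\ldots,d\}$.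
   Context: **Probability spaces.** Let $(H,\langle\cdot,\cdot\rangle)$ be a real Hilbert space and $X_1,\ldots,X_d$ symmetric, densely defined linear operators on $H$. $\mathcal{A}$ is the unital algebra generated by $X_1,\ldots,X_d$ (containing the identity $I$); every $g\in\mathcal{A}$ is $p(X_1,\ldots,X_d)$ for some polynomial $p$ in $d$ noncommutative variables. A unit vector $\phi\in H$ (the vacuum vector) lying in the domain of every $g\in\mathcal{A}$ is fixed. $(\mathcal{A},\phi)$ is called a probability space supported by $H$, elements of $\mathcal{A}$ are random variables, and $\mathbb{E}[g]:=\langle g\phi,\phi\rangle$. **Moment equality.** Two random vectors $(X_1,\ldots,X_d)$, $(Y_1,\ldots,Y_d)$ in probability spaces with expectations $\mathbb{E},\mathbb{E}'$ are moment equal if $\mathbb{E}[p(X_1,\ldots,X_d)]=\mathbb{E}'[p(Y_1,\ldots,Y_d)]$ for every polynomial $p$ in $d$ noncommutative variables. **Annihilation, preservation, creation operators.** For $n\ge 0$ let $F_n=\{p(X_1,\ldots,X_d)\phi: p \text{ a noncommutative polynomial of total degree}\le n\}$. Put $G_{-1}=\{0\}$, $G_0=F_0$, and for $n\ge1$ let $G_n$ be the orthogonal complement of $F_{n-1}$ in $F_n$. Then $\mathcal{A}\phi=\{g\phi:g\in\mathcal{A}\}$ is the algebraic direct sum of the $G_n$ and $X_iG_n\subset G_{n-1}\oplus G_n\oplus G_{n+1}$; $a^-(i),a^0(i),a^+(i)$ are the unique linear operators with domain $\mathcal{A}\phi$ with $X_i=a^-(i)+a^0(i)+a^+(i)$ on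 $\mathcal{A}\phi$, $a^-(i)(G_n)\subset G_{n-1}$, $a^0(i)(G_n)\subset G_n$, $a^+(i)(G_n)\subset G_{n+1}$ for all $n\ge0$. Operator identities are on $\mathcal{A}\phi$. **$q$-commutator.** $[A;B]_q:=AB-q\,BA$. **$q$-Gaussian random variables.** For a real Hilbert space $H_0$ with complexification $H_{\mathbb{C}}$, the $q$-Fock space $\Gamma_q(H_{\mathbb{C}})$ is the closure of $\mathbb{C}\Omega\oplus\bigoplus_{n\ge1} H_{\mathbb{C}}^{\otimes n}$ (algebraic sum; $\Omega$ a unit vacuum vector) in the scalar product \[ \langle f_1\otimes\cdots\otimes f_n,g_1\otimes\cdots\otimes g_m\rangle_q=\delta_{m,n}\sum_{\pi\in S_n}q^{|\pi|}\prod_{j=1}^n\langle f_j,g_{\pi(j)}\rangle,\qquad |\pi|=\#\{(i,j): i<j,\ \pi(i)>\pi(j)\}, \] where for $q=\pm1$ one first divides out the null space; $0^0=1$. For $f$ define $a^+(f)\Omega=f$, $a^+(f)f_1\otimes\cdots\otimes f_n=f\otimes f_1\otimes\cdots\otimes f_n$, $a^-(f)\Omega=0$, and $a^-(f)f_1\otimes\cdots\otimes f_n=\sum_{j=1}^n q^{j-1}\langle f,f_j\rangle f_1\otimes\cdots\otimes f_{j-1}\otimes f_{j+1}\otimes\cdots\otimes f_n$. The operators $x(f)=a^+(f)+a^-(f)$ are called $q$-Gaussian random variables; their expectation is $\mathbb{E}'[g]=\langle g\Omega,\Omega\rangle_q$, so $\mathbb{E}'[x(f_i)x(f_j)]=\langle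 f_i,f_j\rangle$ for $f_i,f_j\in H_0$. *)

theory Defs
  imports
    "HOL-Analysis.Analysis"
    "HOL-Library.Poly_Mapping"
    "HOL-Combinatorics.Permutations"
begin

section \<open>Operators and noncommutative polynomials\<close>

text \<open>
  A possibly unbounded operator is a partial map, its domain being \<^const>\<open>dom\<close>; products are
  \<^const>\<open>map_comp\<close>, and equality of operators includes equality of domains.
\<close>

type_synonym 'v operator = "'v \<rightharpoonup> 'v"

definition linear_operator :: "'v::real_vector operator \<Rightarrow> bool" where
  "linear_operator A \<longleftrightarrow> subspace (dom A) \<and>
     (\<forall>u\<in>dom A. \<forall>v\<in>dom A. the (A (u + v)) = the (A u) + the (A v)) \<and>
     (\<forall>r. \<forall>v\<in>dom A. the (A (r *\<^sub>R v)) = r *\<^sub>R the (A v))"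

text \<open>
  Noncommutative polynomials in variables indexed by \<^typ>\<open>'n\<close>: the finitely supported families of
  real coefficients on words, where the word \<open>[i\<^sub>1, \<dots>, i\<^sub>k]\<close> stands for the monomial
  \<open>X\<^sub>i\<^sub>1 \<cdots> X\<^sub>i\<^sub>k\<close>.
\<close>

type_synonym 'n nc_poly = "'n list \<Rightarrow>\<^sub>0 real"

definition word_operator :: "('n \<Rightarrow> 'v operator) \<Rightarrow> 'n list \<Rightarrow> 'v operator" where
  "word_operator X w = foldr (\<lambda>i A. X i \<circ>\<^sub>m A) w Some"

text \<open>The domain of \<open>p(X)\<close> is the intersection of the domains of the monomials occurring in \<open>p\<close>.\<close>

definition nc_eval :: "'n nc_poly \<Rightarrow> ('n \<Rightarrow> 'v::real_vector operator) \<Rightarrow> 'v operator" where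
  "nc_eval p X v =
     (if \<forall>w\<in>Poly_Mapping.keys p. v \<in> dom (word_operator X w)
      then Some (\<Sum>w\<in>Poly_Mapping.keys p. Poly_Mapping.lookup p w *\<^sub>R the (word_operator X w v)) else None)"

definition generated_algebra :: "('n \<Rightarrow> 'v::real_vector operator) \<Rightarrow> 'v operator set" where
  "generated_algebra X = {nc_eval p X | p. True}"


definition positive_definite :: "real ^ 'n ^ 'n \<Rightarrow> bool" where
  "positive_definite c \<longleftrightarrow> transpose c = c \<and> (\<forall>x. x \<noteq> 0 \<longrightarrow> 0 < x \<bullet> (c *v x))"


section \<open>Probability spaces supported by a real Hilbert space\<close>

definition symmetric_operator :: "'h::real_inner operator \<Rightarrow> bool" where
  "symmetric_operator A \<longleftrightarrow> (\<forall>u\<in>dom A. \<forall>v\<in>dom A. the (A u) \<bullet> v = u \<bullet> the (A v))"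

definition nc_probability_space ::
    "('n::finite \<Rightarrow> 'h::{real_inner, complete_space} operator) \<Rightarrow> 'h \<Rightarrow> bool" where
  "nc_probability_space X \<phi> \<longleftrightarrow>
     (\<forall>i. linear_operator (X i) \<and> closure (dom (X i)) = UNIV \<and> symmetric_operator (X i)) \<and>
     norm \<phi> = 1 \<and> (\<forall>g\<in>generated_algebra X. \<phi> \<in> dom g)"

definition expectation :: "'h::real_inner \<Rightarrow> 'h operator \<Rightarrow> real" where
  "expectation \<phi> g = the (g \<phi>) \<bullet> \<phi>"

text \<open>
  Expectations are taken complex valued so that probability spaces over real and over complex
  Hilbert spaces can be compared.
\<close>

definition moment_equal ::
    "('v::real_vector operator \<Rightarrow> complex) \<Rightarrow> ('n \<Rightarrow> 'v operator) \<Rightarrow>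
     ('w::real_vector operator \<Rightarrow> complex) \<Rightarrow> ('n \<Rightarrow> 'w operator) \<Rightarrow> bool" where
  "moment_equal E X E' Y \<longleftrightarrow> (\<forall>p. E (nc_eval p X) = E' (nc_eval p Y))"


section \<open>Annihilation, preservation and creation operators\<close>

definition cyclic_space :: "('n \<Rightarrow> 'h::real_vector operator) \<Rightarrow> 'h \<Rightarrow> 'h set" where
  "cyclic_space X \<phi> = {the (g \<phi>) | g. g \<in> generated_algebra X}"

definition F_space :: "('n \<Rightarrow> 'h::real_vector operator) \<Rightarrow> 'h \<Rightarrow> nat \<Rightarrow> 'h set" where
  "F_space X \<phi> n = {the (nc_eval p X \<phi>) | p. \<forall>w\<in>Poly_Mapping.keys p. length w \<le> n}"

definition G_space :: "('n \<Rightarrow> 'h::real_inner operator) \<Rightarrow> 'h \<Rightarrow> int \<Rightarrow> 'h set" where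
  "G_space X \<phi> n =
     (if n < 0 then {0}
      else if n = 0 then F_space X \<phi> 0
      else {v \<in> F_space X \<phi> (nat n). \<forall>u\<in>F_space X \<phi> (nat n - 1). orthogonal u v})"

definition is_apc_decomposition ::
    "('n \<Rightarrow> 'h::real_inner operator) \<Rightarrow> 'h \<Rightarrow> 'n \<Rightarrow>
     'h operator \<times> 'h operator \<times> 'h operator \<Rightarrow> bool" where
  "is_apc_decomposition X \<phi> i = (\<lambda>(am, a0, ap).
     (\<forall>a\<in>{am, a0, ap}. linear_operator a \<and> dom a = cyclic_space X \<phi>) \<and>
     (\<forall>v\<in>cyclic_space X \<phi>. X i v = Some (the (am v) + the (a0 v) + the (ap v))) \<and>
     (\<forall>n\<ge>0. \<forall>v\<in>G_space X \<phi> n.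
        the (am v) \<in> G_space X \<phi> (n - 1) \<and>
        the (a0 v) \<in> G_space X \<phi> n \<and>
        the (ap v) \<in> G_space X \<phi> (n + 1)))"

definition apc_decomposition where
  "apc_decomposition X \<phi> i = (THE t. is_apc_decomposition X \<phi> i t)"

definition annihilation ::
    "('n \<Rightarrow> 'h::real_inner operator) \<Rightarrow> 'h \<Rightarrow> 'n \<Rightarrow> 'h operator" where
  "annihilation X \<phi> i = fst (apc_decomposition X \<phi> i)"

definition preservation ::
    "('n \<Rightarrow> 'h::real_inner operator) \<Rightarrow> 'h \<Rightarrow> 'n \<Rightarrow> 'h operator" where
  "preservation X \<phi> i = fst (snd (apc_decomposition X \<phi> i))"

definition creation ::
    "('n \<Rightarrow> 'h::real_inner operator) \<Rightarrow> 'h \<Rightarrow> 'n \<Rightarrow> 'h operator" where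
  "creation X \<phi> i = snd (snd (apc_decomposition X \<phi> i))"

definition q_commutator ::
    "real \<Rightarrow> 'v::real_vector operator \<Rightarrow> 'v operator \<Rightarrow> 'v operator" where
  "q_commutator q A B v =
     (case ((A \<circ>\<^sub>m B) v, (B \<circ>\<^sub>m A) v) of
        (Some x, Some y) \<Rightarrow> Some (x - q *\<^sub>R y)
      | _ \<Rightarrow> None)"


section \<open>The algebraic Fock space over the complexification\<close>

text \<open>
  The complexification of a real inner product space consists of pairs, \<open>(a, b)\<close> standing for
  \<open>a + \<i> b\<close>. Its scalar product is conjugate linear in the first argument; this is
  forced by the complex linearity of the annihilation operators below.
\<close>

definition cscale :: "complex \<Rightarrow> 'k::real_vector \<times> 'k \<Rightarrow> 'k \<times> 'k" where
  "cscale z h = (Re z *\<^sub>R fst h - Im z *\<^sub>R snd h, Re z *\<^sub>R snd h + Im z *\<^sub>R fst h)"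

definition cinner :: "'k::real_inner \<times> 'k \<Rightarrow> 'k \<times> 'k \<Rightarrow> complex" where
  "cinner g h = Complex (fst g \<bullet> fst h + snd g \<bullet> snd h) (fst g \<bullet> snd h - snd g \<bullet> fst h)"

lemma cinner_add_left: "cinner (g + g') h = cinner g h + cinner g' h"
  and cinner_add_right: "cinner g (h + h') = cinner g h + cinner g h'"
  by (simp_all add: cinner_def complex_eq_iff inner_add_left inner_add_right)

lemma cinner_cscale_left: "cinner (cscale z g) h = cnj z * cinner g h"
  and cinner_cscale_right: "cinner g (cscale z h) = z * cinner g h"
  by (simp_all add: cinner_def cscale_def complex_eq_iff inner_add_left inner_add_right
      inner_diff_left inner_diff_right algebra_simps)

text \<open>
  The algebraic direct sum of all tensor powers is the free complex vector space on words of
  vectors modulo the multilinearity relations; the empty word is the vacuum vector.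
\<close>

definition free_scale :: "complex \<Rightarrow> ('w \<Rightarrow>\<^sub>0 complex) \<Rightarrow> ('w \<Rightarrow>\<^sub>0 complex)" where
  "free_scale z S = Poly_Mapping.map ((*) z) S"

lemma lookup_free_scale [simp]: "Poly_Mapping.lookup (free_scale z S) w = z * Poly_Mapping.lookup S w"
  by (simp add: free_scale_def map.rep_eq when_def)

lemma free_scale_add_right: "free_scale z (S + T) = free_scale z S + free_scale z T"
  by (rule poly_mapping_eqI) (simp add: lookup_add distrib_left)

lemma free_scale_add_left: "free_scale (y + z) S = free_scale y S + free_scale z S"
  by (rule poly_mapping_eqI) (simp add: lookup_add distrib_right)

lemma free_scale_free_scale: "free_scale y (free_scale z S) = free_scale (y * z) S"
  by (rule poly_mapping_eqI) simp

lemma free_scale_one: "free_scale 1 S = S"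
  by (rule poly_mapping_eqI) simp

inductive_set multilinear_relations :: "(('k::real_vector \<times> 'k) list \<Rightarrow>\<^sub>0 complex) set" where
  zero: "0 \<in> multilinear_relations"
| add: "S \<in> multilinear_relations \<Longrightarrow> T \<in> multilinear_relations \<Longrightarrow> S + T \<in> multilinear_relations"
| scale: "S \<in> multilinear_relations \<Longrightarrow> free_scale z S \<in> multilinear_relations"
| additive:
    "Poly_Mapping.single (us @ (g + h) # vs) 1 - Poly_Mapping.single (us @ g # vs) 1
       - Poly_Mapping.single (us @ h # vs) 1 \<in> multilinear_relations"
| homogeneous:
    "Poly_Mapping.single (us @ cscale z h # vs) 1 - Poly_Mapping.single (us @ h # vs) z
       \<in> multilinear_relations"

lemma multilinear_relations_uminus:
  "S \<in> multilinear_relations \<Longrightarrow> - S \<in> multilinear_relations"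
proof -
  assume "S \<in> multilinear_relations"
  then have "free_scale (-1) S \<in> multilinear_relations" by (rule multilinear_relations.scale)
  moreover have "free_scale (-1) S = - S" by (rule poly_mapping_eqI) simp
  ultimately show ?thesis by simp
qed

definition multilinear_eq ::
    "(('k::real_vector \<times> 'k) list \<Rightarrow>\<^sub>0 complex) \<Rightarrow> (('k \<times> 'k) list \<Rightarrow>\<^sub>0 complex) \<Rightarrow> bool" where
  "multilinear_eq S T \<longleftrightarrow> S - T \<in> multilinear_relations"

quotient_type (overloaded) 'k fock = "('k::real_inner \<times> 'k) list \<Rightarrow>\<^sub>0 complex" / multilinear_eq
proof (rule equivpI)
  show "reflp multilinear_eq"
    by (simp add: reflp_def multilinear_eq_def multilinear_relations.zero)
  show "symp multilinear_eq"
    unfolding symp_def multilinear_eq_def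
    using multilinear_relations_uminus by fastforce
  show "transp multilinear_eq"
    unfolding transp_def multilinear_eq_def
    using multilinear_relations.add by fastforce
qed

lift_definition tensor :: "('k::real_inner \<times> 'k) list \<Rightarrow> 'k fock" is
  "\<lambda>w. Poly_Mapping.single w 1" .

lift_definition fock_scale :: "complex \<Rightarrow> 'k::real_inner fock \<Rightarrow> 'k fock" is free_scale
proof -
  fix z and S T :: "('k \<times> 'k) list \<Rightarrow>\<^sub>0 complex"
  assume "multilinear_eq S T"
  moreover have "free_scale z S - free_scale z T = free_scale z (S - T)"
    by (rule poly_mapping_eqI) (simp add: lookup_minus right_diff_distrib)
  ultimately show "multilinear_eq (free_scale z S) (free_scale z T)"
    by (simp add: multilinear_eq_def multilinear_relations.scale)
qed

lemma fock_abs_cases: obtains S where "T = abs_fock S"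
  by (induction T rule: fock.abs_induct) auto

instantiation fock :: (real_inner) real_vector
begin

lift_definition zero_fock :: "'a fock" is 0 .

lift_definition plus_fock :: "'a fock \<Rightarrow> 'a fock \<Rightarrow> 'a fock" is "(+)"
  unfolding multilinear_eq_def add_diff_add by (rule multilinear_relations.add)

lift_definition uminus_fock :: "'a fock \<Rightarrow> 'a fock" is uminus
  unfolding multilinear_eq_def minus_diff_minus by (rule multilinear_relations_uminus)

definition minus_fock :: "'a fock \<Rightarrow> 'a fock \<Rightarrow> 'a fock" where
  "minus_fock S T = S + - T"

definition scaleR_fock :: "real \<Rightarrow> 'a fock \<Rightarrow> 'a fock" where
  "scaleR_fock r = fock_scale (complex_of_real r)"

instance
proof
  fix a b c :: "'a fock" and r s :: real
  obtain S where a: "a = abs_fock S" by (rule fock_abs_cases)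
  obtain T where b: "b = abs_fock T" by (rule fock_abs_cases)
  obtain U where c: "c = abs_fock U" by (rule fock_abs_cases)
  show "a + b + c = a + (b + c)"
    by (simp add: a b c plus_fock.abs_eq add.assoc)
  show "a + b = b + a"
    by (simp add: a b plus_fock.abs_eq add.commute)
  show "0 + a = a"
    by (simp add: a plus_fock.abs_eq zero_fock_def)
  show "- a + a = 0"
    by (simp add: a plus_fock.abs_eq uminus_fock.abs_eq zero_fock_def)
  show "a - b = a + - b"
    by (rule minus_fock_def)
  show "r *\<^sub>R (a + b) = r *\<^sub>R a + r *\<^sub>R b"
    by (simp add: a b scaleR_fock_def plus_fock.abs_eq fock_scale.abs_eq free_scale_add_right)
  show "(r + s) *\<^sub>R a = r *\<^sub>R a + s *\<^sub>R a"
    by (simp add: a scaleR_fock_def plus_fock.abs_eq fock_scale.abs_eq free_scale_add_left)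
  show "r *\<^sub>R s *\<^sub>R a = (r * s) *\<^sub>R a"
    by (simp add: a scaleR_fock_def fock_scale.abs_eq free_scale_free_scale)
  show "1 *\<^sub>R a = a"
    by (simp add: a scaleR_fock_def fock_scale.abs_eq free_scale_one)
qed

end

lemma fock_scale_add_right: "fock_scale z (S + T) = fock_scale z S + fock_scale z T"
  by (induction S rule: fock.abs_induct, induction T rule: fock.abs_induct)
    (simp add: plus_fock.abs_eq fock_scale.abs_eq free_scale_add_right)

lemma fock_scale_add_left: "fock_scale (y + z) S = fock_scale y S + fock_scale z S"
  by (induction S rule: fock.abs_induct)
    (simp add: plus_fock.abs_eq fock_scale.abs_eq free_scale_add_left)

lemma fock_scale_fock_scale: "fock_scale y (fock_scale z S) = fock_scale (y * z) S"
  by (induction S rule: fock.abs_induct) (simp add: fock_scale.abs_eq free_scale_free_scale)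

lemma fock_scale_one [simp]: "fock_scale 1 S = S"
  by (induction S rule: fock.abs_induct) (simp add: fock_scale.abs_eq free_scale_one)

lemma fock_scale_zero_right [simp]: "fock_scale z 0 = 0"
  using fock_scale_add_right[of z 0 0] by simp

lemma fock_scale_zero_left [simp]: "fock_scale 0 S = 0"
  using fock_scale_add_left[of 0 0 S] by simp

lemma fock_scale_sum_right: "fock_scale z (sum f A) = (\<Sum>x\<in>A. fock_scale z (f x))"
  by (induction A rule: infinite_finite_induct) (simp_all add: fock_scale_add_right)

lemma tensor_add: "tensor (us @ (g + h) # vs) = tensor (us @ g # vs) + tensor (us @ h # vs)"
  using multilinear_relations.additive[of us g h vs]
  by (simp add: tensor.abs_eq plus_fock.abs_eq fock.abs_eq_iff multilinear_eq_def diff_diff_add)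

lemma tensor_cscale: "tensor (us @ cscale z h # vs) = fock_scale z (tensor (us @ h # vs))"
proof -
  have "free_scale z (Poly_Mapping.single (us @ h # vs) 1) = Poly_Mapping.single (us @ h # vs) z"
    by (rule poly_mapping_eqI) (simp add: lookup_single when_def)
  then show ?thesis
    by (simp add: tensor.abs_eq fock_scale.abs_eq fock.abs_eq_iff multilinear_eq_def
        multilinear_relations.homogeneous)
qed

text \<open>Linear extension of a map given on simple tensors.\<close>

definition free_extend ::
    "(complex \<Rightarrow> 'b \<Rightarrow> 'b::ab_group_add) \<Rightarrow> ('w \<Rightarrow> 'b) \<Rightarrow> ('w \<Rightarrow>\<^sub>0 complex) \<Rightarrow> 'b" where
  "free_extend sc h S = (\<Sum>w\<in>Poly_Mapping.keys S. sc (Poly_Mapping.lookup S w) (h w))"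

definition fock_extend ::
    "(complex \<Rightarrow> 'b \<Rightarrow> 'b::ab_group_add) \<Rightarrow> (('k::real_inner \<times> 'k) list \<Rightarrow> 'b) \<Rightarrow> 'k fock \<Rightarrow> 'b" where
  "fock_extend sc h T = free_extend sc h (rep_fock T)"

definition multilinear_map ::
    "(complex \<Rightarrow> 'b \<Rightarrow> 'b::ab_group_add) \<Rightarrow> (('k::real_vector \<times> 'k) list \<Rightarrow> 'b) \<Rightarrow> bool" where
  "multilinear_map sc h \<longleftrightarrow>
     (\<forall>us g g' vs. h (us @ (g + g') # vs) = h (us @ g # vs) + h (us @ g' # vs)) \<and>
     (\<forall>us z g vs. h (us @ cscale z g # vs) = sc z (h (us @ g # vs)))"

locale complex_scaling =
  fixes sc :: "complex \<Rightarrow> 'b \<Rightarrow> 'b::ab_group_add"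
  assumes sc_add_right: "sc z (a + b) = sc z a + sc z b"
    and sc_add_left: "sc (y + z) a = sc y a + sc z a"
    and sc_sc: "sc y (sc z a) = sc (y * z) a"
    and sc_one: "sc 1 a = a"
begin

lemma sc_zero_left: "sc 0 a = 0"
  using sc_add_left[of 0 0 a] by simp

lemma sc_zero_right: "sc z 0 = 0"
  using sc_add_right[of z 0 0] by simp

lemma sc_sum_right: "sc z (sum f A) = (\<Sum>x\<in>A. sc z (f x))"
  by (induction A rule: infinite_finite_induct) (simp_all add: sc_add_right sc_zero_right)

lemma free_extend_superset:
  "finite A \<Longrightarrow> Poly_Mapping.keys S \<subseteq> A \<Longrightarrow> free_extend sc h S = (\<Sum>w\<in>A. sc (Poly_Mapping.lookup S w) (h w))"
  unfolding free_extend_def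
  by (rule sum.mono_neutral_left) (auto simp: in_keys_iff sc_zero_left)

lemma free_extend_add: "free_extend sc h (S + T) = free_extend sc h S + free_extend sc h T"
proof -
  let ?A = "Poly_Mapping.keys S \<union> Poly_Mapping.keys T"
  have "free_extend sc h (S + T) = (\<Sum>w\<in>?A. sc (Poly_Mapping.lookup (S + T) w) (h w))"
    by (rule free_extend_superset) (simp_all add: keys_add)
  also have "\<dots> = (\<Sum>w\<in>?A. sc (Poly_Mapping.lookup S w) (h w)) + (\<Sum>w\<in>?A. sc (Poly_Mapping.lookup T w) (h w))"
    by (simp add: lookup_add sc_add_left sum.distrib)
  also have "\<dots> = free_extend sc h S + free_extend sc h T"
    by (simp add: free_extend_superset[where A="?A"])
  finally show ?thesis .
qed

lemma free_extend_scale: "free_extend sc h (free_scale z S) = sc z (free_extend sc h S)"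
proof -
  have "free_extend sc h (free_scale z S) = (\<Sum>w\<in>Poly_Mapping.keys S. sc (Poly_Mapping.lookup (free_scale z S) w) (h w))"
    by (rule free_extend_superset) (auto simp: in_keys_iff)
  also have "\<dots> = sc z (free_extend sc h S)"
    by (simp add: free_extend_def sc_sum_right sc_sc)
  finally show ?thesis .
qed

lemma free_extend_zero: "free_extend sc h 0 = 0"
  by (simp add: free_extend_def)

lemma free_extend_uminus: "free_extend sc h (- S) = - free_extend sc h S"
  using free_extend_add[of h "- S" S] by (simp add: free_extend_zero eq_neg_iff_add_eq_0)

lemma free_extend_diff: "free_extend sc h (S - T) = free_extend sc h S - free_extend sc h T"
  using free_extend_add[of h S "- T"] by (simp add: free_extend_uminus)

lemma free_extend_single: "free_extend sc h (Poly_Mapping.single w z) = sc z (h w)"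
  by (simp add: free_extend_def sc_zero_left)

lemma free_extend_respects:
  assumes h: "multilinear_map sc h" and ST: "multilinear_eq S T"
  shows "free_extend sc h S = free_extend sc h T"
proof -
  have "free_extend sc h R = 0" if "R \<in> multilinear_relations" for R
    using that
    by induction (simp_all add: free_extend_zero free_extend_add free_extend_scale
        free_extend_diff free_extend_single sc_zero_right sc_one h[unfolded multilinear_map_def])
  then show ?thesis
    using ST free_extend_diff[of h S T] by (simp add: multilinear_eq_def)
qed

end

interpretation fock: complex_scaling fock_scale
  by unfold_locales
    (simp_all add: fock_scale_add_right fock_scale_add_left fock_scale_fock_scale)

interpretation complex: complex_scaling "(*)"
  by unfold_locales (simp_all add: algebra_simps)

interpretation cnj: complex_scaling "\<lambda>z. (*) (cnj z)"
  by unfold_locales (simp_all add: algebra_simps)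


section \<open>q-Gaussian random variables\<close>

definition perm_inversions :: "nat \<Rightarrow> (nat \<Rightarrow> nat) \<Rightarrow> nat" where
  "perm_inversions n \<pi> = card {(i, j). i < j \<and> j < n \<and> \<pi> i > \<pi> j}"

definition word_inner ::
    "real \<Rightarrow> ('k::real_inner \<times> 'k) list \<Rightarrow> ('k \<times> 'k) list \<Rightarrow> complex" where
  "word_inner q fs gs =
     (if length fs = length gs
      then \<Sum>\<pi> | \<pi> permutes {..<length fs}.
             complex_of_real q ^ perm_inversions (length fs) \<pi> *
             (\<Prod>j<length fs. cinner (fs ! j) (gs ! \<pi> j))
      else 0)"

lemma word_inner_combine:
  assumes "length fs1 = length fs" "length fs2 = length fs"
    "length gs1 = length gs" "length gs2 = length gs"
    and eq: "\<And>\<pi>. \<pi> permutes {..<length fs} \<Longrightarrow> length gs = length fs \<Longrightarrow>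
      (\<Prod>j<length fs. cinner (fs ! j) (gs ! \<pi> j)) =
      y * (\<Prod>j<length fs. cinner (fs1 ! j) (gs1 ! \<pi> j)) +
      z * (\<Prod>j<length fs. cinner (fs2 ! j) (gs2 ! \<pi> j))"
  shows "word_inner q fs gs = y * word_inner q fs1 gs1 + z * word_inner q fs2 gs2"
proof (cases "length fs = length gs")
  case True
  let ?I = "\<lambda>\<pi>. complex_of_real q ^ perm_inversions (length fs) \<pi>"
  have "word_inner q fs gs =
      (\<Sum>\<pi> | \<pi> permutes {..<length fs}.
         y * (?I \<pi> * (\<Prod>j<length fs. cinner (fs1 ! j) (gs1 ! \<pi> j))) +
         z * (?I \<pi> * (\<Prod>j<length fs. cinner (fs2 ! j) (gs2 ! \<pi> j))))"
    unfolding word_inner_def using True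
    by (auto intro!: sum.cong simp: eq[unfolded True] distrib_left mult.left_commute)
  also have "\<dots> = y * word_inner q fs1 gs1 + z * word_inner q fs2 gs2"
    using True assms(1-4) by (simp add: word_inner_def sum.distrib sum_distrib_left)
  finally show ?thesis .
qed (use assms(1-4) in \<open>simp add: word_inner_def\<close>)

lemma word_inner_add_right:
  "word_inner q fs (us @ (g + h) # vs) = word_inner q fs (us @ g # vs) + word_inner q fs (us @ h # vs)"
  and word_inner_cscale_right:
  "word_inner q fs (us @ cscale z h # vs) = z * word_inner q fs (us @ h # vs)"
proof -
  let ?n = "length fs" and ?k = "length us"
  have split: "\<exists>a C. \<forall>x. (\<Prod>j<?n. cinner (fs ! j) ((us @ x # vs) ! \<pi> j)) = cinner a x * C"
    if perm: "\<pi> permutes {..<?n}" and len: "?n = length us + Suc (length vs)" for \<pi>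
  proof -
    obtain j where j: "j < ?n" "\<pi> j = ?k"
      using permutes_image[OF perm] len
      by (metis add_Suc_right imageE lessThan_iff less_add_Suc1)
    have ne: "\<pi> i \<noteq> ?k" if "i \<noteq> j" for i
      using that j(2) permutes_inj[OF perm] by (metis injD)
    have "(\<Prod>j<?n. cinner (fs ! j) ((us @ x # vs) ! \<pi> j)) =
        cinner (fs ! j) x * (\<Prod>i\<in>{..<?n} - {j}. cinner (fs ! i) ((us @ 0 # vs) ! \<pi> i))" for x
    proof -
      have "(\<Prod>j<?n. cinner (fs ! j) ((us @ x # vs) ! \<pi> j)) =
          cinner (fs ! j) ((us @ x # vs) ! \<pi> j) *
          (\<Prod>i\<in>{..<?n} - {j}. cinner (fs ! i) ((us @ x # vs) ! \<pi> i))"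
        using j by (intro prod.remove) auto
      also have "(\<Prod>i\<in>{..<?n} - {j}. cinner (fs ! i) ((us @ x # vs) ! \<pi> i)) =
          (\<Prod>i\<in>{..<?n} - {j}. cinner (fs ! i) ((us @ 0 # vs) ! \<pi> i))"
        using ne by (intro prod.cong) (auto simp: nth_append nth_Cons')
      finally show ?thesis using j by simp
    qed
    then show ?thesis by blast
  qed
  show "word_inner q fs (us @ (g + h) # vs) =
      word_inner q fs (us @ g # vs) + word_inner q fs (us @ h # vs)"
  proof -
    have "word_inner q fs (us @ (g + h) # vs) =
        1 * word_inner q fs (us @ g # vs) + 1 * word_inner q fs (us @ h # vs)"
    proof (rule word_inner_combine)
      fix \<pi> assume perm: "\<pi> permutes {..<?n}" and len: "length (us @ (g + h) # vs) = ?n"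
      obtain a C where "\<And>x. (\<Prod>j<?n. cinner (fs ! j) ((us @ x # vs) ! \<pi> j)) = cinner a x * C"
        using split[OF perm] len by (metis length_append length_Cons)
      then show "(\<Prod>j<?n. cinner (fs ! j) ((us @ (g + h) # vs) ! \<pi> j)) =
          1 * (\<Prod>j<?n. cinner (fs ! j) ((us @ g # vs) ! \<pi> j)) +
          1 * (\<Prod>j<?n. cinner (fs ! j) ((us @ h # vs) ! \<pi> j))"
        by (simp only: cinner_add_right distrib_right mult_1)
    qed simp_all
    then show ?thesis by simp
  qed
  show "word_inner q fs (us @ cscale z h # vs) = z * word_inner q fs (us @ h # vs)"
  proof -
    have "word_inner q fs (us @ cscale z h # vs) =
        z * word_inner q fs (us @ h # vs) + 0 * word_inner q fs (us @ h # vs)"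
    proof (rule word_inner_combine)
      fix \<pi> assume perm: "\<pi> permutes {..<?n}" and len: "length (us @ cscale z h # vs) = ?n"
      obtain a C where "\<And>x. (\<Prod>j<?n. cinner (fs ! j) ((us @ x # vs) ! \<pi> j)) = cinner a x * C"
        using split[OF perm] len by (metis length_append length_Cons)
      then show "(\<Prod>j<?n. cinner (fs ! j) ((us @ cscale z h # vs) ! \<pi> j)) =
          z * (\<Prod>j<?n. cinner (fs ! j) ((us @ h # vs) ! \<pi> j)) +
          0 * (\<Prod>j<?n. cinner (fs ! j) ((us @ h # vs) ! \<pi> j))"
        by (simp only: cinner_cscale_right mult.assoc mult_zero_left add_0_right)
    qed simp_all
    then show ?thesis by simp
  qed
qed

lemma word_inner_add_left:
  "word_inner q (us @ (g + h) # vs) gs = word_inner q (us @ g # vs) gs + word_inner q (us @ h # vs) gs"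
  and word_inner_cscale_left:
  "word_inner q (us @ cscale z h # vs) gs = cnj z * word_inner q (us @ h # vs) gs"
proof -
  let ?n = "length us + Suc (length vs)" and ?k = "length us"
  have split: "(\<Prod>j<?n. cinner ((us @ x # vs) ! j) (gs ! \<pi> j)) =
      cinner x (gs ! \<pi> ?k) * (\<Prod>j\<in>{..<?n} - {?k}. cinner ((us @ 0 # vs) ! j) (gs ! \<pi> j))"
    for x and \<pi> :: "nat \<Rightarrow> nat"
  proof -
    have "(\<Prod>j<?n. cinner ((us @ x # vs) ! j) (gs ! \<pi> j)) =
        cinner ((us @ x # vs) ! ?k) (gs ! \<pi> ?k) *
        (\<Prod>j\<in>{..<?n} - {?k}. cinner ((us @ x # vs) ! j) (gs ! \<pi> j))"
      by (intro prod.remove) auto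
    also have "(\<Prod>j\<in>{..<?n} - {?k}. cinner ((us @ x # vs) ! j) (gs ! \<pi> j)) =
        (\<Prod>j\<in>{..<?n} - {?k}. cinner ((us @ 0 # vs) ! j) (gs ! \<pi> j))"
      by (intro prod.cong) (auto simp: nth_append nth_Cons')
    finally show ?thesis by simp
  qed
  have "word_inner q (us @ (g + h) # vs) gs =
      1 * word_inner q (us @ g # vs) gs + 1 * word_inner q (us @ h # vs) gs"
    by (rule word_inner_combine)
      (simp_all only: length_append length_Cons split cinner_add_left distrib_right mult_1)
  then show "word_inner q (us @ (g + h) # vs) gs =
      word_inner q (us @ g # vs) gs + word_inner q (us @ h # vs) gs"
    by simp
  have "word_inner q (us @ cscale z h # vs) gs =
      cnj z * word_inner q (us @ h # vs) gs + 0 * word_inner q (us @ h # vs) gs"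
    by (rule word_inner_combine)
      (simp_all only: length_append length_Cons split cinner_cscale_left mult.assoc
        mult_zero_left add_0_right)
  then show "word_inner q (us @ cscale z h # vs) gs = cnj z * word_inner q (us @ h # vs) gs"
    by simp
qed

text \<open>
  The sesquilinear extension of the scalar product from words to the tensor algebra. Dividing out
  its null space and completing changes neither the scalar products of vectors of the tensor
  algebra nor, therefore, the moments of the field operators, which leave the tensor algebra
  invariant; hence these two steps are not carried out.
\<close>

definition fock_inner :: "real \<Rightarrow> 'k::real_inner fock \<Rightarrow> 'k fock \<Rightarrow> complex" where
  "fock_inner q S T =
     fock_extend (\<lambda>z. (*) (cnj z)) (\<lambda>fs. fock_extend (*) (word_inner q fs) T) S"

definition fock_creation :: "'k::real_inner \<times> 'k \<Rightarrow> 'k fock \<Rightarrow> 'k fock" where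
  "fock_creation f = fock_extend fock_scale (\<lambda>fs. tensor (f # fs))"

text \<open>Positions are counted from zero, whence the exponent \<open>j\<close> in place of \<open>j - 1\<close>.\<close>

definition word_annihilation ::
    "real \<Rightarrow> 'k::real_inner \<times> 'k \<Rightarrow> ('k \<times> 'k) list \<Rightarrow> 'k fock" where
  "word_annihilation q f fs =
     (\<Sum>j<length fs. fock_scale (complex_of_real q ^ j * cinner f (fs ! j))
                      (tensor (take j fs @ drop (Suc j) fs)))"

definition fock_annihilation :: "real \<Rightarrow> 'k::real_inner \<times> 'k \<Rightarrow> 'k fock \<Rightarrow> 'k fock" where
  "fock_annihilation q f = fock_extend fock_scale (word_annihilation q f)"

definition q_gaussian :: "real \<Rightarrow> 'k::real_inner \<Rightarrow> 'k fock operator" where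
  "q_gaussian q f T = Some (fock_creation (f, 0) T + fock_annihilation q (f, 0) T)"

definition q_expectation :: "real \<Rightarrow> 'k::real_inner fock operator \<Rightarrow> complex" where
  "q_expectation q g = fock_inner q (the (g (tensor []))) (tensor [])"


subsection \<open>The operations are well defined\<close>

text \<open>
  The operations above satisfy the formulas on simple tensors from which they were extended.
\<close>

context complex_scaling
begin

lemma fock_extend_abs:
  assumes "multilinear_map sc h"
  shows "fock_extend sc h (abs_fock S) = free_extend sc h S"
  unfolding fock_extend_def
proof (rule free_extend_respects[OF assms])
  show "multilinear_eq (rep_fock (abs_fock S)) S"
    by (metis Quotient3_def Quotient3_fock Quotient3_rep_abs fock.abs_eq_iff)
qed

lemma fock_extend_tensor:
  "multilinear_map sc h \<Longrightarrow> fock_extend sc h (tensor w) = h w"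
  by (simp add: tensor.abs_eq fock_extend_abs free_extend_single sc_one)

lemma fock_extend_add:
  assumes "multilinear_map sc h"
  shows "fock_extend sc h (S + T) = fock_extend sc h S + fock_extend sc h T"
proof (induction S rule: fock.abs_induct)
  case (1 S)
  show ?case
    by (induction T rule: fock.abs_induct)
      (simp add: plus_fock.abs_eq fock_extend_abs[OF assms] free_extend_add)
qed

lemma fock_extend_scale:
  assumes "multilinear_map sc h"
  shows "fock_extend sc h (fock_scale z T) = sc z (fock_extend sc h T)"
  by (induction T rule: fock.abs_induct)
    (simp add: fock_scale.abs_eq fock_extend_abs[OF assms] free_extend_scale)

end

lemma multilinear_word_inner: "multilinear_map (*) (word_inner q fs)"
  by (simp add: multilinear_map_def word_inner_add_right word_inner_cscale_right)

lemma multilinear_fock_inner: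
  "multilinear_map (\<lambda>z. (*) (cnj z)) (\<lambda>fs. fock_extend (*) (word_inner q fs) T)"
  by (simp add: multilinear_map_def fock_extend_def free_extend_def word_inner_add_left
      word_inner_cscale_left sum.distrib[symmetric] distrib_left sum_distrib_left
      mult.left_commute)

lemma multilinear_fock_creation: "multilinear_map fock_scale (\<lambda>fs. tensor (f # fs))"
  using tensor_add[of "f # us" for us] tensor_cscale[of "f # us" for us]
  by (simp add: multilinear_map_def)

lemma multilinear_fock_annihilation: "multilinear_map fock_scale (word_annihilation q f)"
proof -
  have split: "word_annihilation q f (us @ x # vs) =
      (\<Sum>j<length us. fock_scale (complex_of_real q ^ j * cinner f (us ! j))
          (tensor ((take j us @ drop (Suc j) us) @ x # vs))) +
      fock_scale (complex_of_real q ^ length us * cinner f x) (tensor (us @ vs)) +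
      (\<Sum>j<length vs. fock_scale (complex_of_real q ^ (Suc (length us + j)) * cinner f (vs ! j))
          (tensor (us @ x # take j vs @ drop (Suc j) vs)))" for us x vs
  proof -
    have "{..<length (us @ x # vs)} =
        {..<length us} \<union> {length us} \<union> (\<lambda>j. Suc (length us + j)) ` {..<length vs}"
    proof (rule set_eqI)
      fix i
      show "i \<in> {..<length (us @ x # vs)} \<longleftrightarrow>
          i \<in> {..<length us} \<union> {length us} \<union> (\<lambda>j. Suc (length us + j)) ` {..<length vs}"
        by (auto simp: image_iff intro!: bexI[of _ "i - Suc (length us)"])
    qed
    then have "word_annihilation q f (us @ x # vs) =
        (\<Sum>j\<in>{..<length us} \<union> {length us} \<union> (\<lambda>j. Suc (length us + j)) ` {..<length vs}.
          fock_scale (complex_of_real q ^ j * cinner f ((us @ x # vs) ! j))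
            (tensor (take j (us @ x # vs) @ drop (Suc j) (us @ x # vs))))"
      by (simp only: word_annihilation_def)
    also have "\<dots> = 
        (\<Sum>j<length us. fock_scale (complex_of_real q ^ j * cinner f ((us @ x # vs) ! j))
            (tensor (take j (us @ x # vs) @ drop (Suc j) (us @ x # vs)))) +
        fock_scale (complex_of_real q ^ length us * cinner f x) (tensor (us @ vs)) +
        (\<Sum>j\<in>(\<lambda>j. Suc (length us + j)) ` {..<length vs}.
          fock_scale (complex_of_real q ^ j * cinner f ((us @ x # vs) ! j))
            (tensor (take j (us @ x # vs) @ drop (Suc j) (us @ x # vs))))"
      by (subst sum.union_disjoint; (subst sum.union_disjoint)?) auto
    finally show ?thesis
      by (simp add: sum.reindex inj_on_def nth_append Suc_diff_le)
  qed
  have add: "tensor (us @ ws @ (g + h) # vs) = tensor (us @ ws @ g # vs) + tensor (us @ ws @ h # vs)"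
    and scale: "tensor (us @ ws @ cscale z h # vs) = fock_scale z (tensor (us @ ws @ h # vs))"
    for us ws vs g h z
    using tensor_add[of "us @ ws"] tensor_cscale[of "us @ ws"] by auto
  show ?thesis
    unfolding multilinear_map_def split
    by (simp add: add scale tensor_add tensor_cscale cinner_add_right cinner_cscale_right
        fock_scale_add_right fock_scale_add_left distrib_left sum.distrib fock_scale_sum_right
        fock_scale_fock_scale mult.left_commute mult.commute algebra_simps)
qed

lemma fock_inner_tensor: "fock_inner q (tensor fs) (tensor gs) = word_inner q fs gs"
  unfolding fock_inner_def
  by (subst cnj.fock_extend_tensor[OF multilinear_fock_inner])
    (rule complex.fock_extend_tensor[OF multilinear_word_inner])

lemma fock_creation_tensor: "fock_creation f (tensor fs) = tensor (f # fs)"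
  by (simp add: fock_creation_def fock.fock_extend_tensor[OF multilinear_fock_creation])

lemma fock_annihilation_tensor:
  "fock_annihilation q f (tensor fs) =
     (\<Sum>j<length fs. fock_scale (complex_of_real q ^ j * cinner f (fs ! j))
                      (tensor (take j fs @ drop (Suc j) fs)))"
  by (simp add: fock_annihilation_def fock.fock_extend_tensor[OF multilinear_fock_annihilation]
      word_annihilation_def)

end

theory Submission
  imports Defs
begin

text \<open>
  Both directions rest on one recursion. Suppose vectors \<open>\<psi> u\<close>, indexed by words \<open>u\<close>, satisfy
  \<open>\<psi> [] = \<phi>\<close> and
  \<open>X\<^sub>i (\<psi> u) = \<psi> (i # u) + (\<Sum>j. q\<^sup>j c(i, u\<^sub>j) \<psi> (u without position j))\<close>,
  and \<open>\<phi>\<close> is orthogonal to \<open>\<psi> u\<close> for every nonempty \<open>u\<close>. Applying the operators one after the other then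
  computes every moment by a rule that mentions only \<open>q\<close> and \<open>c\<close> (\<open>wick_moment_unique\<close>). In the Fock
  space the simple tensors \<open>f\<^sub>u\<^sub>1 \<otimes> \<cdots> \<otimes> f\<^sub>u\<^sub>n\<close> form such a family, by the very definition of
  the creation and annihilation operators, so the moments of the q-Gaussian vector are the numbers
  \<open>wick_moment\<close>, and moment equality means that the moments of \<open>X\<close> are these numbers too.

  Suppose that the commutation relations hold. The preservation operators vanish by induction on
  the degree: \<open>a\<^sup>0(j) \<phi>\<close> is a multiple of \<open>\<phi>\<close> with coefficient \<open>E[X\<^sub>j] = 0\<close>; and if \<open>a\<^sup>0(j)\<close> vanishes in
  degree \<open>n\<close>, then for \<open>v\<close> of degree \<open>n + 1\<close> the vector \<open>a\<^sup>0(j) v\<close> is killed by every \<open>a\<^sup>-(i)\<close>, which by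
  symmetry of the \<open>X\<^sub>i\<close> makes it orthogonal to everything of degree at most \<open>n + 1\<close>, itself
  included (\<open>annihilated_imp_zero\<close>). So \<open>X\<^sub>i = a\<^sup>+(i) + a\<^sup>-(i)\<close>, and the q-commutator moves \<open>a\<^sup>-(i)\<close> through
  a product of creation operators down to the vacuum, which shows that
  \<open>\<psi> u = a\<^sup>+(u\<^sub>1) \<cdots> a\<^sup>+(u\<^sub>n) \<phi>\<close> is a family of the required kind.

  Conversely, let the moments agree. Solving the recursion for \<open>\<psi> (i # u)\<close> defines vectors, the
  q-Wick products, which span the cyclic space. Moment equality gives
  \<open>\<langle>X\<^sub>w \<psi> u, \<phi>\<rangle> = wick_moment (rev w) u\<close>, and this vanishes when \<open>w\<close> is shorter than \<open>u\<close>, since one step of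
  the recursion shortens \<open>u\<close> by at most one letter. As the \<open>X\<^sub>i\<close> are symmetric, \<open>\<psi> u\<close> is orthogonal to
  all vectors of lower degree, that is, homogeneous of degree \<open>length u\<close>. The recursion therefore
  exhibits the homogeneous components of \<open>X\<^sub>i (\<psi> u)\<close>: the creation operator prepends \<open>i\<close>, the
  preservation operator is zero, the annihilation operator is the contraction sum. The commutation
  relations can be read off on the \<open>\<psi> u\<close>.

  The vectors \<open>f\<^sub>i\<close> with Gram matrix \<open>c\<close> come from a Cholesky factorization.
\<close>

section \<open>Gram representation of positive definite matrices\<close>

text \<open>
  Cholesky factorization, by induction on the index set: the Schur complement of the entry at the
  new index is again positive definite, and its factor is extended by one column.
\<close>

lemma gram_representation:
  fixes c :: "'n \<Rightarrow> 'n \<Rightarrow> real"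
  assumes "finite I"
    and "\<And>i j. i \<in> I \<Longrightarrow> j \<in> I \<Longrightarrow> c i j = c j i"
    and "\<And>x. \<exists>i\<in>I. x i \<noteq> 0 \<Longrightarrow> 0 < (\<Sum>i\<in>I. \<Sum>j\<in>I. x i * x j * c i j)"
  shows "\<exists>g. \<forall>i\<in>I. \<forall>j\<in>I. (\<Sum>k\<in>I. g i k * g j k) = c i j"
  using assms
proof (induction I arbitrary: c rule: finite_induct)
  case empty
  then show ?case by simp
next
  case (insert a I)
  note fin = insert.hyps(1) and a = insert.hyps(2) and sym = insert.prems(1)
  \<comment> \<open>The pivot is the value of the quadratic form at the unit vector of index \<open>a\<close>.\<close>
  have pos: "0 < c a a"
  proof -
    let ?e = "\<lambda>i. of_bool (i = a) :: real"
    have zero: "(\<Sum>j\<in>I. ?e j * y j) = 0" for y :: "'n \<Rightarrow> real"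
      using a by (intro sum.neutral) auto
    have "0 < (\<Sum>i\<in>insert a I. \<Sum>j\<in>insert a I. ?e i * ?e j * c i j)"
      by (rule insert.prems(2)) auto
    also have "\<dots> = c a a"
      using fin a zero by (simp add: mult.assoc flip: sum_distrib_left)
    finally show ?thesis .
  qed
  define c' where "c' i j = c i j - c i a * c j a / c a a" for i j
  have "\<exists>g. \<forall>i\<in>I. \<forall>j\<in>I. (\<Sum>k\<in>I. g i k * g j k) = c' i j"
  proof (rule insert.IH)
    show "c' i j = c' j i" if "i \<in> I" "j \<in> I" for i j
      using that sym by (simp add: c'_def)
    fix x :: "'n \<Rightarrow> real"
    assume x: "\<exists>i\<in>I. x i \<noteq> 0"
    define s where "s = (\<Sum>i\<in>I. x i * c i a)"
    \<comment> \<open>This value at \<open>a\<close> minimizes the form of \<open>c\<close> among the extensions of \<open>x\<close>; the minimum is the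
        form of the Schur complement at \<open>x\<close>.\<close>
    define y where "y = x(a := - s / c a a)"
    have y: "y i = x i" if "i \<in> I" for i
      using that a by (auto simp: y_def)
    have ya: "y a = - s / c a a"
      by (simp add: y_def)
    have s': "(\<Sum>i\<in>I. x i * c a i) = s"
      unfolding s_def by (intro sum.cong) (auto simp: sym)
    have "0 < (\<Sum>i\<in>insert a I. \<Sum>j\<in>insert a I. y i * y j * c i j)"
      by (rule insert.prems(2)) (use x y in auto)
    also have "\<dots> = y a * y a * c a a + y a * (\<Sum>j\<in>I. x j * c a j) + y a * (\<Sum>i\<in>I. x i * c i a)
        + (\<Sum>i\<in>I. \<Sum>j\<in>I. x i * x j * c i j)"
      using fin a by (simp add: y sum.distrib sum_distrib_left algebra_simps)
    also have "\<dots> = (\<Sum>i\<in>I. \<Sum>j\<in>I. x i * x j * c i j) - s * s / c a a"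
      using pos unfolding s' s_def[symmetric] ya by (simp add: field_simps)
    also have "s * s / c a a = (\<Sum>i\<in>I. \<Sum>j\<in>I. x i * x j * (c i a * c j a / c a a))"
      unfolding s_def sum_product sum_divide_distrib
      by (intro sum.cong refl) (simp add: algebra_simps)
    also have "(\<Sum>i\<in>I. \<Sum>j\<in>I. x i * x j * c i j) - \<dots> = (\<Sum>i\<in>I. \<Sum>j\<in>I. x i * x j * c' i j)"
      by (simp add: c'_def sum_subtractf right_diff_distrib)
    finally show "0 < (\<Sum>i\<in>I. \<Sum>j\<in>I. x i * x j * c' i j)" .
  qed
  then obtain g where g: "\<And>i j. i \<in> I \<Longrightarrow> j \<in> I \<Longrightarrow> (\<Sum>k\<in>I. g i k * g j k) = c' i j"
    by blast
  define h where "h i k = (if k = a then c i a / sqrt (c a a) else if i = a then 0 else g i k)" for i k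
  have h: "(\<Sum>k\<in>insert a I. h i k * h j k) =
      c i a * c j a / c a a + (\<Sum>k\<in>I. (if i = a then 0 else g i k) * (if j = a then 0 else g j k))" for i j
  proof -
    have "(\<Sum>k\<in>I. h i k * h j k) =
        (\<Sum>k\<in>I. (if i = a then 0 else g i k) * (if j = a then 0 else g j k))"
      using a by (intro sum.cong) (auto simp: h_def)
    then show ?thesis
      using fin a pos by (simp add: h_def field_simps)
  qed
  have "(\<Sum>k\<in>insert a I. h i k * h j k) = c i j" if ij: "i \<in> insert a I" "j \<in> insert a I" for i j
  proof (cases "i = a \<or> j = a")
    case True
    then have "c i a * c j a / c a a = c i j"
      using pos sym ij by auto
    moreover have "(\<Sum>k\<in>I. (if i = a then 0 else g i k) * (if j = a then 0 else g j k)) = 0"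
      using True by (intro sum.neutral) auto
    ultimately show ?thesis
      unfolding h by simp
  next
    case False
    then show ?thesis
      using ij g[of i j] unfolding h by (simp add: c'_def)
  qed
  then show ?case by blast
qed

lemma positive_definite_gram:
  fixes c :: "real ^ 'n ^ 'n"
  assumes "positive_definite c"
  shows "\<exists>f :: 'n \<Rightarrow> real ^ 'n. \<forall>i j. f i \<bullet> f j = c $ i $ j"
proof -
  have sym: "c $ i $ j = c $ j $ i" for i j
    using assms unfolding positive_definite_def transpose_def vec_eq_iff by (metis vec_lambda_beta)
  have pos: "0 < (\<Sum>i\<in>UNIV. \<Sum>j\<in>UNIV. x i * x j * c $ i $ j)"
    if "\<exists>i\<in>UNIV. x i \<noteq> 0" for x :: "'n \<Rightarrow> real"
  proof -
    have "(\<chi> i. x i) \<noteq> 0"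
      using that by (auto simp: vec_eq_iff)
    then have "0 < (\<chi> i. x i) \<bullet> (c *v (\<chi> i. x i))"
      using assms unfolding positive_definite_def by blast
    then show ?thesis
      by (simp add: inner_vec_def matrix_vector_mult_def sum_distrib_left mult.left_commute mult.commute)
  qed
  obtain g :: "'n \<Rightarrow> 'n \<Rightarrow> real" where g: "\<And>i j. (\<Sum>k\<in>UNIV. g i k * g j k) = c $ i $ j"
    using gram_representation[of UNIV "\<lambda>i j. c $ i $ j", OF _ sym pos] by auto
  then have "(\<chi> k. g i k) \<bullet> (\<chi> k. g j k) = c $ i $ j" for i j
    by (simp add: inner_vec_def)
  then show ?thesis by (intro exI[of _ "\<lambda>i. \<chi> k. g i k"]) blast
qed

section \<open>Linear maps on subspaces\<close>

text \<open>
  Unbounded operators are represented by total functions, whose values are meaningful on a common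
  invariant domain only.
\<close>

definition linear_map_on :: "'v::real_vector set \<Rightarrow> ('v \<Rightarrow> 'w::real_vector) \<Rightarrow> bool" where
  "linear_map_on D h \<longleftrightarrow> subspace D \<and> (\<forall>u\<in>D. \<forall>v\<in>D. h (u + v) = h u + h v) \<and>
     (\<forall>r. \<forall>v\<in>D. h (r *\<^sub>R v) = r *\<^sub>R h v)"

lemma linear_map_on_0: "linear_map_on D h \<Longrightarrow> h 0 = 0"
  unfolding linear_map_on_def using subspace_0 by (metis scaleR_zero_left)

lemma linear_map_on_sum:
  assumes "linear_map_on D h" and "\<And>k. k \<in> K \<Longrightarrow> v k \<in> D"
  shows "h (\<Sum>k\<in>K. v k) = (\<Sum>k\<in>K. h (v k))"
  using assms(2)
proof (induction K rule: infinite_finite_induct)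
  case (insert k K)
  then have "(\<Sum>k\<in>K. v k) \<in> D"
    using assms(1) by (intro subspace_sum) (auto simp: linear_map_on_def)
  then show ?case
    using insert assms(1) by (auto simp: linear_map_on_def)
qed (simp_all add: linear_map_on_0[OF assms(1)])

lemma linear_map_on_foldr:
  assumes "subspace D" and "\<And>i. linear_map_on D (x i)" and "\<And>i v. v \<in> D \<Longrightarrow> x i v \<in> D"
  shows "linear_map_on D (foldr x w)" and "v \<in> D \<Longrightarrow> foldr x w v \<in> D"
proof -
  have "linear_map_on D (foldr x w) \<and> (\<forall>v\<in>D. foldr x w v \<in> D)"
    by (induction w) (use assms in \<open>auto simp: linear_map_on_def\<close>)
  then show "linear_map_on D (foldr x w)" and "v \<in> D \<Longrightarrow> foldr x w v \<in> D"
    by auto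
qed

lemma linear_map_on_span:
  assumes "linear_map_on D h" and "S \<subseteq> D" and "subspace T" and "\<And>s. s \<in> S \<Longrightarrow> h s \<in> T"
    and "v \<in> span S"
  shows "h v \<in> T"
proof -
  have "subspace {v \<in> D. h v \<in> T}"
    using assms(1,3) linear_map_on_0[OF assms(1)] by (auto simp: subspace_def linear_map_on_def)
  then have "span S \<subseteq> {v \<in> D. h v \<in> T}"
    by (rule span_minimal[rotated]) (use assms in auto)
  then show ?thesis using assms(5) by auto
qed

lemma linear_map_on_diff:
  "linear_map_on D h \<Longrightarrow> linear_map_on D k \<Longrightarrow> linear_map_on D (\<lambda>v. h v - k v)"
  by (simp add: linear_map_on_def scaleR_diff_right)

lemma linear_map_on_scale:
  "linear_map_on D h \<Longrightarrow> linear_map_on D (\<lambda>v. r *\<^sub>R h v)"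
  by (simp add: linear_map_on_def scaleR_add_right)

lemma linear_map_on_compose:
  "linear_map_on D h \<Longrightarrow> linear_map_on D k \<Longrightarrow> (\<And>v. v \<in> D \<Longrightarrow> k v \<in> D) \<Longrightarrow>
    linear_map_on D (\<lambda>v. h (k v))"
  by (simp add: linear_map_on_def)

lemma linear_map_on_span_eq:
  assumes "linear_map_on D h" and "linear_map_on D k" and "S \<subseteq> D"
    and "\<And>s. s \<in> S \<Longrightarrow> h s = k s" and "v \<in> span S"
  shows "h v = k v"
proof -
  have "linear_map_on D (\<lambda>v. h v - k v)"
    by (rule linear_map_on_diff) (fact assms)+
  then have "h v - k v \<in> {0}"
    by (rule linear_map_on_span) (use assms in auto)
  then show ?thesis by simp
qed

text \<open>
  The space need not be finite dimensional, but a finite spanning set of the subspace can be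
  orthogonalized, which gives the projection by a formula.
\<close>

lemma finite_span_projection:
  fixes B :: "'a::real_inner set"
  assumes "finite B"
  shows "\<exists>P. linear P \<and> (\<forall>v. P v \<in> span B) \<and> (\<forall>v. \<forall>u\<in>span B. u \<bullet> (v - P v) = 0)"
proof -
  obtain C where C: "finite C" "span C = span B" "pairwise orthogonal C"
    using basis_orthogonal[OF assms] by blast
  define P where "P v = (\<Sum>b\<in>C. (b \<bullet> v / (b \<bullet> b)) *\<^sub>R b)" for v
  have "linear P"
    unfolding P_def
    by (rule linearI)
      (simp_all add: inner_add_right add_divide_distrib scaleR_add_left sum.distrib scaleR_sum_right)
  moreover have "P v \<in> span B" for v
    unfolding P_def C(2)[symmetric] by (intro span_sum span_mul span_base)
  moreover have "u \<bullet> (v - P v) = 0" if "u \<in> span B" for u v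
  proof -
    have base: "b \<bullet> (v - P v) = 0" if b: "b \<in> C" for b
    proof -
      have "b \<bullet> P v = (\<Sum>a\<in>C. (a \<bullet> v / (a \<bullet> a)) * (b \<bullet> a))"
        by (simp add: P_def inner_sum_right)
      also have "\<dots> = (\<Sum>a\<in>C. if a = b then b \<bullet> v else 0)"
        using C(3) b by (intro sum.cong refl) (auto simp: pairwise_def orthogonal_def)
      also have "\<dots> = b \<bullet> v"
        using C(1) b by simp
      finally show ?thesis by (simp add: inner_diff_right)
    qed
    have "linear_map_on UNIV (\<lambda>u. u \<bullet> (v - P v))"
      by (simp add: linear_map_on_def inner_add_left)
    then have "u \<bullet> (v - P v) \<in> {0}"
      by (rule linear_map_on_span[where S = C]) (use base that C(2) in auto)
    then show ?thesis by simp
  qed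
  ultimately show ?thesis by blast
qed

section \<open>Contractions and the moment recursion\<close>

text \<open>
  The action of a q-annihilation operator on a family \<open>h\<close> of vectors indexed by words; \<open>a k\<close> is the
  scalar product of its vector with the vector belonging to the letter \<open>k\<close>.
\<close>

definition contraction :: "real \<Rightarrow> ('n \<Rightarrow> real) \<Rightarrow> ('n list \<Rightarrow> 'v::real_vector) \<Rightarrow> 'n list \<Rightarrow> 'v" where
  "contraction q a h u = (\<Sum>j<length u. (q ^ j * a (u ! j)) *\<^sub>R h (take j u @ drop (Suc j) u))"

lemma contraction_Nil [simp]: "contraction q a h [] = 0"
  by (simp add: contraction_def)

text \<open>
  This is the relation \<open>a\<^sup>- a\<^sup>+(j) = a j + q a\<^sup>+(j) a\<^sup>-\<close> in terms of words.
\<close>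

lemma contraction_Cons:
  "contraction q a h (j # u) = a j *\<^sub>R h u + q *\<^sub>R contraction q a (\<lambda>v. h (j # v)) u"
  unfolding contraction_def
  by (simp add: sum.lessThan_Suc_shift scaleR_sum_right mult.assoc del: sum.lessThan_Suc)

text \<open>
  The length information lets recursive definitions through a contraction terminate.
\<close>

lemma contraction_cong [fundef_cong]:
  "u = u' \<Longrightarrow> (\<And>v. Suc (length v) = length u' \<Longrightarrow> h v = h' v) \<Longrightarrow> contraction q a h u = contraction q a h' u'"
  unfolding contraction_def by (auto intro!: sum.cong)

lemma contraction_in_subspace:
  assumes "subspace S" and "\<And>v. Suc (length v) = length u \<Longrightarrow> h v \<in> S"
  shows "contraction q a h u \<in> S"
  unfolding contraction_def using assms by (intro subspace_sum subspace_scale) auto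

lemma contraction_eq_0:
  assumes "\<And>v. Suc (length v) = length u \<Longrightarrow> h v = 0"
  shows "contraction q a h u = 0"
  unfolding contraction_def using assms by (intro sum.neutral) auto

lemma linear_map_on_contraction:
  assumes "linear_map_on D h" and "\<And>v. Suc (length v) = length u \<Longrightarrow> g v \<in> D"
  shows "h (contraction q a g u) = contraction q a (\<lambda>v. h (g v)) u"
proof -
  have D: "subspace D" and h: "\<And>r v. v \<in> D \<Longrightarrow> h (r *\<^sub>R v) = r *\<^sub>R h v"
    using assms(1) by (auto simp: linear_map_on_def)
  have g: "g (take j u @ drop (Suc j) u) \<in> D" if "j < length u" for j
    using that by (intro assms(2)) auto
  show ?thesis
    unfolding contraction_def
    by (subst linear_map_on_sum[OF assms(1)]) (auto intro!: sum.cong simp: h g subspace_scale[OF D])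
qed

text \<open>
  The vacuum expectation of the operators of the word \<open>w\<close>, the head of \<open>w\<close> being applied first, on
  the vector indexed by \<open>u\<close>. Since the leftmost factor of an operator product is applied last, the
  moment of the product along \<open>w\<close> is \<open>wick_moment q c (rev w) []\<close>.
\<close>

primrec wick_moment :: "real \<Rightarrow> ('n \<Rightarrow> 'n \<Rightarrow> real) \<Rightarrow> 'n list \<Rightarrow> 'n list \<Rightarrow> real" where
  "wick_moment q c [] = (\<lambda>u. of_bool (u = []))"
| "wick_moment q c (i # w) =
     (\<lambda>u. wick_moment q c w (i # u) + contraction q (c i) (wick_moment q c w) u)"

text \<open>
  Each letter of \<open>w\<close> shortens the second word by at most one, so the empty word is never reached.
\<close>

lemma wick_moment_eq_0: "length w < length u \<Longrightarrow> wick_moment q c w u = 0"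
  by (induction w arbitrary: u) (auto intro!: contraction_eq_0)

text \<open>
  The recursion determines the moments. The functional \<open>E\<close> takes values in an arbitrary algebra so
  that the result covers both the complex q-Fock space and the real cyclic space of \<open>X\<close>.
\<close>

theorem wick_moment_unique:
  fixes x :: "'n \<Rightarrow> 'v::real_vector \<Rightarrow> 'v" and E :: "'v \<Rightarrow> 'a::real_algebra_1"
  assumes D: "subspace D" and x: "\<And>i. linear_map_on D (x i)" "\<And>i v. v \<in> D \<Longrightarrow> x i v \<in> D"
    and E: "linear_map_on D E"
    and \<psi>: "\<And>u. \<psi> u \<in> D"
    and step: "\<And>i u. x i (\<psi> u) = \<psi> (i # u) + contraction q (c i) \<psi> u"
    and vac: "\<And>u. E (\<psi> u) = of_bool (u = [])"
  shows "E (foldr x (rev w) (\<psi> u)) = of_real (wick_moment q c w u)"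
proof (induction w arbitrary: u)
  case Nil
  then show ?case by (simp add: vac)
next
  case (Cons i w)
  have lin: "linear_map_on D (\<lambda>v. E (foldr x (rev w) v))"
    using E linear_map_on_foldr[where x = x and w = "rev w", OF D x] by (simp add: linear_map_on_def)
  have con: "contraction q (c i) \<psi> u \<in> D"
    by (rule contraction_in_subspace[OF D]) (rule \<psi>)
  have "E (foldr x (rev (i # w)) (\<psi> u)) = E (foldr x (rev w) (\<psi> (i # u) + contraction q (c i) \<psi> u))"
    by (simp add: step)
  also have "\<dots> = E (foldr x (rev w) (\<psi> (i # u))) + E (foldr x (rev w) (contraction q (c i) \<psi> u))"
    using lin \<psi> con by (simp add: linear_map_on_def)
  also have "E (foldr x (rev w) (contraction q (c i) \<psi> u)) = contraction q (c i) (\<lambda>v. E (foldr x (rev w) (\<psi> v))) u"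
    by (rule linear_map_on_contraction[OF lin]) (rule \<psi>)
  also have "\<dots> = of_real (contraction q (c i) (wick_moment q c w) u)"
    by (simp add: Cons.IH contraction_def scaleR_conv_of_real)
  finally show ?case by (simp add: Cons.IH)
qed

section \<open>Moments of q-Gaussian random variables\<close>

lemma word_operator_Nil [simp]: "word_operator X [] = Some"
  by (simp add: word_operator_def)

lemma word_operator_Cons [simp]: "word_operator X (i # w) = X i \<circ>\<^sub>m word_operator X w"
  by (simp add: word_operator_def)

definition gaussian_map :: "real \<Rightarrow> 'k::real_inner \<Rightarrow> 'k fock \<Rightarrow> 'k fock" where
  "gaussian_map q f T = fock_creation (f, 0) T + fock_annihilation q (f, 0) T"

lemma q_gaussian_word_operator:
  "word_operator (\<lambda>i. q_gaussian q (f i)) w T = Some (foldr (\<lambda>i. gaussian_map q (f i)) w T)"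
  by (induction w) (simp_all add: q_gaussian_def gaussian_map_def)

lemma linear_gaussian_map: "linear_map_on UNIV (gaussian_map q f)"
  unfolding linear_map_on_def gaussian_map_def fock_creation_def fock_annihilation_def scaleR_fock_def
  by (simp add: fock.fock_extend_add[OF multilinear_fock_creation]
      fock.fock_extend_add[OF multilinear_fock_annihilation]
      fock.fock_extend_scale[OF multilinear_fock_creation]
      fock.fock_extend_scale[OF multilinear_fock_annihilation] fock_scale_add_right)

lemma linear_fock_inner: "linear_map_on UNIV (\<lambda>T. fock_inner q T U)"
  unfolding linear_map_on_def fock_inner_def scaleR_fock_def
  by (simp add: cnj.fock_extend_add[OF multilinear_fock_inner]
      cnj.fock_extend_scale[OF multilinear_fock_inner] scaleR_conv_of_real)

lemma word_inner_Nil: "word_inner q fs [] = of_bool (fs = [])"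
  by (simp add: word_inner_def perm_inversions_def)

text \<open>
  Simple tensors satisfy the recursion because creation prepends a factor and annihilation is the
  contraction with the Gram matrix; the scalar products are real, so no conjugation appears.
\<close>

lemma gaussian_map_tensor:
  fixes f :: "'n \<Rightarrow> 'k::real_inner"
  assumes "\<And>i j. f i \<bullet> f j = c i j"
  shows "gaussian_map q (f i) (tensor (map (\<lambda>i. (f i, 0)) u)) =
    tensor (map (\<lambda>i. (f i, 0)) (i # u)) + contraction q (c i) (\<lambda>v. tensor (map (\<lambda>i. (f i, 0)) v)) u"
proof -
  have "cinner (f i, 0) (f j, 0) = complex_of_real (c i j)" for i j
    by (simp add: cinner_def assms complex_eq_iff)
  then show ?thesis
    by (simp add: gaussian_map_def fock_creation_tensor fock_annihilation_tensor contraction_def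
        scaleR_fock_def take_map drop_map)
qed

lemma q_gaussian_moment:
  fixes f :: "'n \<Rightarrow> 'k::real_inner"
  assumes "\<And>i j. f i \<bullet> f j = c i j"
  shows "fock_inner q (foldr (\<lambda>i. gaussian_map q (f i)) w (tensor [])) (tensor []) =
    complex_of_real (wick_moment q c (rev w) [])"
  using wick_moment_unique[of UNIV "\<lambda>i. gaussian_map q (f i)" "\<lambda>T. fock_inner q T (tensor [])"
      "\<lambda>u. tensor (map (\<lambda>i. (f i, 0)) u)" q c "rev w" "[]",
      OF _ linear_gaussian_map _ linear_fock_inner _ gaussian_map_tensor[OF assms]]
  by (simp add: fock_inner_tensor word_inner_Nil)

lemma q_expectation_nc_eval:
  fixes f :: "'n \<Rightarrow> 'k::real_inner"
  assumes "\<And>i j. f i \<bullet> f j = c i j"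
  shows "q_expectation q (nc_eval p (\<lambda>i. q_gaussian q (f i))) =
    complex_of_real (\<Sum>w\<in>Poly_Mapping.keys p. Poly_Mapping.lookup p w * wick_moment q c (rev w) [])"
proof -
  have "q_expectation q (nc_eval p (\<lambda>i. q_gaussian q (f i))) =
      fock_inner q (\<Sum>w\<in>Poly_Mapping.keys p. Poly_Mapping.lookup p w *\<^sub>R
        foldr (\<lambda>i. gaussian_map q (f i)) w (tensor [])) (tensor [])"
    by (simp add: q_expectation_def nc_eval_def q_gaussian_word_operator dom_def)
  also have "\<dots> = (\<Sum>w\<in>Poly_Mapping.keys p. fock_inner q (Poly_Mapping.lookup p w *\<^sub>R
        foldr (\<lambda>i. gaussian_map q (f i)) w (tensor [])) (tensor []))"
    by (rule linear_map_on_sum[OF linear_fock_inner]) simp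
  also have "\<dots> = (\<Sum>w\<in>Poly_Mapping.keys p. Poly_Mapping.lookup p w *\<^sub>R
        complex_of_real (wick_moment q c (rev w) []))"
    using linear_fock_inner[of q "tensor [] :: 'k fock"]
    by (simp add: linear_map_on_def q_gaussian_moment[OF assms])
  finally show ?thesis by (simp add: scaleR_conv_of_real)
qed

section \<open>The cyclic space and its grading\<close>

lemma sum_over_keys_span:
  fixes g :: "'a \<Rightarrow> 'v::real_vector"
  shows "{\<Sum>w\<in>Poly_Mapping.keys p. Poly_Mapping.lookup p w *\<^sub>R g w | p. Poly_Mapping.keys p \<subseteq> S} = span (g ` S)"
    (is "?L = _")
proof
  show "?L \<subseteq> span (g ` S)"
  proof clarify
    fix p :: "'a \<Rightarrow>\<^sub>0 real" assume "Poly_Mapping.keys p \<subseteq> S"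
    then show "(\<Sum>w\<in>Poly_Mapping.keys p. Poly_Mapping.lookup p w *\<^sub>R g w) \<in> span (g ` S)"
      by (intro span_sum span_mul span_base) auto
  qed
  have "subspace ?L"
    unfolding subspace_def
  proof (intro conjI ballI allI)
    show "0 \<in> ?L"
      by (rule CollectI, rule exI[of _ 0]) simp
  next
    fix a b assume "a \<in> ?L" "b \<in> ?L"
    then obtain p r where a: "a = (\<Sum>w\<in>Poly_Mapping.keys p. Poly_Mapping.lookup p w *\<^sub>R g w)"
      and b: "b = (\<Sum>w\<in>Poly_Mapping.keys r. Poly_Mapping.lookup r w *\<^sub>R g w)"
      and sub: "Poly_Mapping.keys p \<subseteq> S" "Poly_Mapping.keys r \<subseteq> S"
      by auto
    let ?K = "Poly_Mapping.keys p \<union> Poly_Mapping.keys r"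
    have sup: "(\<Sum>w\<in>Poly_Mapping.keys s. Poly_Mapping.lookup s w *\<^sub>R g w) =
        (\<Sum>w\<in>?K. Poly_Mapping.lookup s w *\<^sub>R g w)" if "Poly_Mapping.keys s \<subseteq> ?K" for s
      using that by (intro sum.mono_neutral_left) (auto simp: in_keys_iff)
    have "a + b = (\<Sum>w\<in>Poly_Mapping.keys (p + r). Poly_Mapping.lookup (p + r) w *\<^sub>R g w)"
      unfolding a b sup[OF keys_add] sup[OF Un_upper1] sup[OF Un_upper2]
      by (simp add: lookup_add scaleR_add_left sum.distrib)
    moreover have "Poly_Mapping.keys (p + r) \<subseteq> S"
      using keys_add[of p r] sub by blast
    ultimately show "a + b \<in> ?L" by blast
  next
    fix r :: real and a assume "a \<in> ?L"
    then obtain p where a: "a = (\<Sum>w\<in>Poly_Mapping.keys p. Poly_Mapping.lookup p w *\<^sub>R g w)"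
      and sub: "Poly_Mapping.keys p \<subseteq> S"
      by auto
    let ?p = "Poly_Mapping.map ((*) r) p"
    have look: "Poly_Mapping.lookup ?p w = r * Poly_Mapping.lookup p w" for w
      by (simp add: map.rep_eq when_def)
    have keys: "Poly_Mapping.keys ?p \<subseteq> Poly_Mapping.keys p"
      by (auto simp: in_keys_iff look)
    have "(\<Sum>w\<in>Poly_Mapping.keys ?p. Poly_Mapping.lookup ?p w *\<^sub>R g w) =
        (\<Sum>w\<in>Poly_Mapping.keys p. Poly_Mapping.lookup ?p w *\<^sub>R g w)"
      using keys by (intro sum.mono_neutral_left) (auto simp: in_keys_iff)
    then have "r *\<^sub>R a = (\<Sum>w\<in>Poly_Mapping.keys ?p. Poly_Mapping.lookup ?p w *\<^sub>R g w)"
      unfolding a by (simp add: look scaleR_sum_right)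
    then show "r *\<^sub>R a \<in> ?L" using keys sub by blast
  qed
  moreover have "g ` S \<subseteq> ?L"
  proof
    fix a assume "a \<in> g ` S"
    then obtain w where "w \<in> S" "a = g w" by auto
    then show "a \<in> ?L"
      by (intro CollectI exI[of _ "Poly_Mapping.single w 1"]) simp
  qed
  ultimately show "span (g ` S) \<subseteq> ?L"
    by (rule span_minimal[rotated])
qed

text \<open>
  In this setting every operator product may be applied to the vacuum, so the partial operators
  can be replaced by total functions on the cyclic space.
\<close>

locale vacuum_space =
  fixes X :: "'n::finite \<Rightarrow> 'h::{real_inner, complete_space} operator" and \<phi> :: 'h
  assumes prob: "nc_probability_space X \<phi>"
begin

definition word_vector :: "'n list \<Rightarrow> 'h" where
  "word_vector w = the (word_operator X w \<phi>)"

definition x :: "'n \<Rightarrow> 'h \<Rightarrow> 'h" where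
  "x i v = the (X i v)"

abbreviation D :: "'h set" where "D \<equiv> cyclic_space X \<phi>"
abbreviation F :: "nat \<Rightarrow> 'h set" where "F \<equiv> F_space X \<phi>"
abbreviation G :: "nat \<Rightarrow> 'h set" where "G n \<equiv> G_space X \<phi> (int n)"

lemma word_operator_vacuum: "word_operator X w \<phi> = Some (word_vector w)"
proof -
  have "\<phi> \<in> dom (nc_eval (Poly_Mapping.single w 1) X)"
    using prob by (auto simp: nc_probability_space_def generated_algebra_def)
  then have "\<phi> \<in> dom (word_operator X w)"
    by (auto simp: nc_eval_def dom_def split: if_splits)
  then show ?thesis by (auto simp: word_vector_def)
qed

lemma word_vector_Nil [simp]: "word_vector [] = \<phi>"
  by (simp add: word_vector_def)

lemma X_word_vector: "X i (word_vector w) = Some (word_vector (i # w))"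
  using word_operator_vacuum[of "i # w"] by (simp add: word_operator_vacuum)

lemma x_word_vector: "x i (word_vector w) = word_vector (i # w)"
  by (simp add: x_def X_word_vector)

lemma word_vector_eq_foldr: "word_vector w = foldr x w \<phi>"
  by (induction w) (simp_all flip: x_word_vector)

lemma nc_eval_vacuum:
  "nc_eval p X \<phi> = Some (\<Sum>w\<in>Poly_Mapping.keys p. Poly_Mapping.lookup p w *\<^sub>R word_vector w)"
  by (simp add: nc_eval_def word_operator_vacuum dom_def)

lemma F_eq: "F n = span (word_vector ` {w. length w \<le> n})"
  unfolding F_space_def nc_eval_vacuum sum_over_keys_span[symmetric] by auto

lemma D_eq: "D = span (range word_vector)"
  unfolding cyclic_space_def generated_algebra_def sum_over_keys_span[of word_vector UNIV, symmetric]
  by (auto simp: nc_eval_vacuum) (metis nc_eval_vacuum option.sel)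

lemma subspace_D: "subspace D" and subspace_F: "subspace (F n)"
  by (simp_all add: D_eq F_eq)

lemma F_mono: "m \<le> n \<Longrightarrow> F m \<subseteq> F n"
  unfolding F_eq by (intro span_mono) auto

lemma F_subset_D: "F n \<subseteq> D"
  unfolding F_eq D_eq by (intro span_mono) auto

lemma word_vector_in_F: "length w \<le> n \<Longrightarrow> word_vector w \<in> F n"
  unfolding F_eq by (intro span_base) auto

lemma vacuum_in_F: "\<phi> \<in> F n"
  using word_vector_in_F[of "[]" n] by simp

text \<open>
  A polynomial has finitely many monomials, so its degree is bounded.
\<close>

lemma in_F_if_in_D:
  assumes "v \<in> D" obtains n where "v \<in> F n"
proof -
  obtain p where p: "v = (\<Sum>w\<in>Poly_Mapping.keys p. Poly_Mapping.lookup p w *\<^sub>R word_vector w)"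
    using assms by (auto simp: cyclic_space_def generated_algebra_def nc_eval_vacuum)
  have "v \<in> F (Max (length ` Poly_Mapping.keys p))"
    unfolding p by (intro subspace_sum subspace_F subspace_scale word_vector_in_F) simp
  then show thesis by (rule that)
qed

lemma D_subset_dom: "D \<subseteq> dom (X i)"
  unfolding D_eq
proof (rule span_minimal)
  show "range word_vector \<subseteq> dom (X i)"
    using X_word_vector by blast
  show "subspace (dom (X i))"
    using prob by (simp add: nc_probability_space_def linear_operator_def)
qed

lemma X_on_D: "v \<in> D \<Longrightarrow> X i v = Some (x i v)"
  using D_subset_dom[of i] by (auto simp: x_def)

lemma linear_x: "linear_map_on D (x i)"
  using prob D_subset_dom[of i] subspace_D unfolding linear_map_on_def x_def
  by (auto simp: nc_probability_space_def linear_operator_def subset_iff)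

lemma symmetric_x: "u \<in> D \<Longrightarrow> v \<in> D \<Longrightarrow> x i u \<bullet> v = u \<bullet> x i v"
  using prob D_subset_dom[of i] unfolding x_def
  by (auto simp: nc_probability_space_def symmetric_operator_def subset_iff)

lemma x_F: "v \<in> F n \<Longrightarrow> x i v \<in> F (Suc n)"
  unfolding F_eq[of n]
  by (rule linear_map_on_span[OF linear_x, rotated, OF subspace_F])
    (auto simp: x_word_vector D_eq intro!: word_vector_in_F span_base)

lemma x_D: "v \<in> D \<Longrightarrow> x i v \<in> D"
  by (metis F_subset_D in_F_if_in_D subsetD x_F)

lemma G_0: "G 0 = F 0"
  by (simp add: G_space_def)

lemma G_Suc: "G (Suc n) = {v \<in> F (Suc n). \<forall>u\<in>F n. u \<bullet> v = 0}"
  by (simp add: G_space_def orthogonal_def nat_add_distrib)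

lemma G_neg: "k < 0 \<Longrightarrow> G_space X \<phi> k = {0}"
  by (simp add: G_space_def)

lemma subspace_G: "subspace (G_space X \<phi> k)"
proof (cases "k < 0")
  case False
  then obtain n where k: "k = int n" by (metis int_nat_eq not_less)
  show ?thesis
  proof (cases n)
    case (Suc m)
    then show ?thesis
      using subspace_F[of n] unfolding k by (auto simp: G_Suc[of m] subspace_def inner_add_right simp del: of_nat_Suc)
  qed (simp add: k G_0[simplified] subspace_F)
qed (simp add: G_neg)

lemma G_subset_F: "G n \<subseteq> F n"
  by (cases n) (auto simp: G_0[simplified] G_Suc simp del: of_nat_Suc)

lemma G_subset_D: "G_space X \<phi> k \<subseteq> D"
proof (cases "k < 0")
  case True
  then show ?thesis by (simp add: G_neg subspace_0[OF subspace_D])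
next
  case False
  then have "k = int (nat k)" by simp
  then show ?thesis using G_subset_F[of "nat k"] F_subset_D by (metis subset_trans)
qed

lemma F_orthogonal_G:
  assumes "u \<in> F m" and "v \<in> G n" and "m < n"
  shows "u \<bullet> v = 0"
proof -
  obtain k where k: "n = Suc k" "m \<le> k"
    using assms(3) by (metis less_Suc_eq_le less_imp_Suc_add less_add_Suc1)
  then show ?thesis using F_mono[OF k(2)] assms by (auto simp: G_Suc simp del: of_nat_Suc)
qed

lemma G_orthogonal:
  assumes "u \<in> G_space X \<phi> k" and "v \<in> G_space X \<phi> l" and "k \<noteq> l"
  shows "u \<bullet> v = 0"
proof (cases "k < 0 \<or> l < 0")
  case True
  then show ?thesis using assms G_neg by auto
next
  case False
  then obtain m n where "k = int m" "l = int n" by (metis int_nat_eq not_less)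
  then show ?thesis
    using assms F_orthogonal_G[of u m v n] F_orthogonal_G[of v n u m] G_subset_F
    by (metis inner_commute linorder_neqE_nat subsetD)
qed

text \<open>
  This makes the decomposition of \<open>X\<^sub>i\<close> unique, and later identifies its parts on q-Wick products.
\<close>

lemma G_components_unique:
  assumes "a \<in> G_space X \<phi> (k - 1)" "a' \<in> G_space X \<phi> (k - 1)" "b \<in> G_space X \<phi> k" "b' \<in> G_space X \<phi> k"
    "e \<in> G_space X \<phi> (k + 1)" "e' \<in> G_space X \<phi> (k + 1)"
    and eq: "a + b + e = a' + b' + e'"
  shows "a = a'" "b = b'" "e = e'"
proof -
  let ?a = "a - a'" and ?b = "b - b'" and ?e = "e - e'"
  have mem: "?a \<in> G_space X \<phi> (k - 1)" "?b \<in> G_space X \<phi> k" "?e \<in> G_space X \<phi> (k + 1)"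
    using assms subspace_diff[OF subspace_G] by auto
  have orth: "?a \<bullet> ?b = 0" "?a \<bullet> ?e = 0" "?b \<bullet> ?e = 0"
    by (rule G_orthogonal[OF mem(1,2)] G_orthogonal[OF mem(1,3)] G_orthogonal[OF mem(2,3)]; simp)+
  have "?a + ?b + ?e = 0"
    using eq by (simp add: algebra_simps)
  then have "?a \<bullet> (?a + ?b + ?e) = 0" "?b \<bullet> (?a + ?b + ?e) = 0" "?e \<bullet> (?a + ?b + ?e) = 0"
    by (simp_all only: inner_zero_right)
  then have "?a \<bullet> ?a = 0" "?b \<bullet> ?b = 0" "?e \<bullet> ?e = 0"
    unfolding inner_add_right using orth by (simp_all only: inner_commute[of ?b ?a] inner_commute[of ?e ?a] inner_commute[of ?e ?b] add_0_left add_0_right)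
  then show "a = a'" "b = b'" "e = e'"
    by (simp_all only: inner_eq_zero_iff right_minus_eq)
qed

section \<open>Existence and uniqueness of annihilation, preservation and creation operators\<close>

text \<open>
  The \<open>F n\<close> are finite dimensional because there are finitely many variables; hence the
  projections exist even though the cyclic space need not be complete.
\<close>

definition proj_F :: "nat \<Rightarrow> 'h \<Rightarrow> 'h" where
  "proj_F n = (SOME p. linear p \<and> (\<forall>v. p v \<in> F n) \<and> (\<forall>v. \<forall>u\<in>F n. u \<bullet> (v - p v) = 0))"

lemma linear_proj_F: "linear (proj_F n)" and proj_F_in_F: "proj_F n v \<in> F n"
  and proj_F_orthogonal: "u \<in> F n \<Longrightarrow> u \<bullet> (v - proj_F n v) = 0"
proof -
  have "finite {w :: 'n list. length w \<le> n}"
    using finite_lists_length_le[of "UNIV :: 'n set" n] by simp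
  then have "\<exists>p. linear p \<and> (\<forall>v. p v \<in> F n) \<and> (\<forall>v. \<forall>u\<in>F n. u \<bullet> (v - p v) = 0)"
    unfolding F_eq by (intro finite_span_projection finite_imageI)
  then have "linear (proj_F n) \<and> (\<forall>v. proj_F n v \<in> F n) \<and> (\<forall>v. \<forall>u\<in>F n. u \<bullet> (v - proj_F n v) = 0)"
    unfolding proj_F_def by (rule someI_ex)
  then show "linear (proj_F n)" and "proj_F n v \<in> F n" and "u \<in> F n \<Longrightarrow> u \<bullet> (v - proj_F n v) = 0"
    by auto
qed

lemma proj_F_unique:
  assumes "p \<in> F n" and "\<And>u. u \<in> F n \<Longrightarrow> u \<bullet> (v - p) = 0"
  shows "proj_F n v = p"
proof -
  have "p - proj_F n v \<in> F n"
    using assms(1) proj_F_in_F by (rule subspace_diff[OF subspace_F])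
  then have "(p - proj_F n v) \<bullet> ((v - proj_F n v) - (v - p)) = 0"
    unfolding inner_diff_right[of _ "v - proj_F n v"] by (simp add: proj_F_orthogonal assms(2) del: inner_diff_right)
  then show ?thesis by simp
qed

lemma proj_F_id: "v \<in> F n \<Longrightarrow> proj_F n v = v"
  by (rule proj_F_unique) simp_all

definition proj_G :: "nat \<Rightarrow> 'h \<Rightarrow> 'h" where
  "proj_G n v = (case n of 0 \<Rightarrow> proj_F 0 v | Suc m \<Rightarrow> proj_F n v - proj_F m v)"

lemma proj_G_simps: "proj_G 0 = proj_F 0" "proj_G (Suc n) v = proj_F (Suc n) v - proj_F n v"
  by (simp_all add: proj_G_def fun_eq_iff)

lemma linear_proj_G: "linear (proj_G n)"
proof (cases n)
  case 0
  then show ?thesis by (simp add: proj_G_simps linear_proj_F)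
next
  case (Suc m)
  have "linear (\<lambda>v. proj_F (Suc m) v - proj_F m v)"
    by (intro linear_compose_sub linear_proj_F)
  then show ?thesis by (simp add: Suc proj_G_def[abs_def])
qed

lemma proj_G_in_G: "proj_G n v \<in> G n"
proof (cases n)
  case 0
  then show ?thesis using proj_F_in_F[of 0 v] by (simp add: proj_G_simps G_0[simplified])
next
  case (Suc m)
  have F: "F m \<subseteq> F (Suc m)" by (rule F_mono) simp
  have "proj_F (Suc m) v - proj_F m v \<in> F (Suc m)"
    using proj_F_in_F F by (intro subspace_diff subspace_F) auto
  moreover have "u \<bullet> (proj_F (Suc m) v - proj_F m v) = 0" if "u \<in> F m" for u
    using proj_F_orthogonal[of u m v] proj_F_orthogonal[of u "Suc m" v] F that by (auto simp: inner_diff_right)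
  ultimately show ?thesis by (simp add: Suc proj_G_simps G_Suc del: of_nat_Suc)
qed

lemma proj_F_G: "v \<in> G n \<Longrightarrow> proj_F m v = (if n \<le> m then v else 0)"
proof -
  assume v: "v \<in> G n"
  have "v \<in> F m" if "n \<le> m" using that v G_subset_F F_mono by blast
  moreover have "proj_F m v = 0" if "m < n"
    by (rule proj_F_unique) (use F_orthogonal_G[OF _ v that] subspace_0[OF subspace_F] in auto)
  ultimately show ?thesis by (simp add: proj_F_id)
qed

lemma proj_G_G: "v \<in> G n \<Longrightarrow> proj_G m v = (if m = n then v else 0)"
  by (cases m) (auto simp: proj_G_simps proj_F_G)

lemma proj_G_above: "v \<in> F n \<Longrightarrow> n < m \<Longrightarrow> proj_G m v = 0"
  using F_mono[of n m] F_mono[of n "m - 1"] by (cases m) (auto simp: proj_G_simps proj_F_id subset_iff)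

lemma proj_F_eq_sum_proj_G: "proj_F n v = (\<Sum>m\<le>n. proj_G m v)"
  by (induction n) (simp_all add: proj_G_simps)

lemma D_eq_span_G: "D = span (\<Union>n. G n)"
proof
  show "D \<subseteq> span (\<Union>n. G n)"
  proof
    fix v assume "v \<in> D"
    then obtain n where "v \<in> F n" by (rule in_F_if_in_D)
    then have "v = (\<Sum>m\<le>n. proj_G m v)" by (simp add: proj_F_id flip: proj_F_eq_sum_proj_G)
    also have "\<dots> \<in> span (\<Union>n. G n)"
      using proj_G_in_G by (intro span_sum span_base) blast
    finally show "v \<in> span (\<Union>n. G n)" .
  qed
  show "span (\<Union>n. G n) \<subseteq> D"
    using G_subset_D subspace_D by (intro span_minimal) auto
qed

text \<open>
  An operator raises the degree by at most one; being symmetric, it also lowers it by at most one.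
\<close>

lemma x_G:
  assumes "v \<in> G n"
  shows "x i v = (case n of 0 \<Rightarrow> 0 | Suc m \<Rightarrow> proj_G m (x i v)) + proj_G n (x i v) + proj_G (Suc n) (x i v)"
proof -
  have v: "v \<in> F n" using assms G_subset_F by blast
  have x: "x i v = proj_F (Suc n) (x i v)" using x_F[OF v] by (simp add: proj_F_id)
  have low: "proj_F m (x i v) = 0" if "Suc m < n" for m
  proof (rule proj_F_unique)
    fix u assume u: "u \<in> F m"
    have "x i u \<bullet> v = 0"
      by (rule F_orthogonal_G[OF x_F[OF u] assms that])
    then show "u \<bullet> (x i v - 0) = 0"
      using symmetric_x[of u v i] u v F_subset_D by auto
  qed (rule subspace_0[OF subspace_F])
  show ?thesis
  proof (cases n)
    case 0
    then show ?thesis using x by (simp add: proj_G_simps)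
  next
    case (Suc m)
    then show ?thesis using x low by (cases m) (simp_all add: proj_G_simps)
  qed
qed

text \<open>
  The part of \<open>h\<close> that maps degree \<open>s n\<close> to degree \<open>r n\<close>, for all \<open>n\<close>. On the cyclic space the series has
  finitely many nonzero terms, so it is an algebraic sum, written without choosing a bound on the
  degree of the argument.
\<close>

definition band :: "('h \<Rightarrow> 'h) \<Rightarrow> (nat \<Rightarrow> nat) \<Rightarrow> (nat \<Rightarrow> nat) \<Rightarrow> 'h \<Rightarrow> 'h" where
  "band h r s v = suminf (\<lambda>n. proj_G (r n) (h (proj_G (s n) v)))"

lemma linear_band:
  assumes h: "linear_map_on D h" and s: "\<And>n. n \<le> s n"
  shows "linear_map_on D (band h r s)"
proof -
  let ?f = "\<lambda>v n. proj_G (r n) (h (proj_G (s n) v))"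
  have QD: "proj_G n v \<in> D" for n v using proj_G_in_G G_subset_D by blast
  have h0: "proj_G n (h 0) = 0" for n
    by (simp add: linear_map_on_0[OF h] linear_0[OF linear_proj_G])
  have sm: "summable (?f v)" if v: "v \<in> D" for v
  proof -
    obtain N where N: "v \<in> F N" by (rule in_F_if_in_D[OF v])
    have "?f v n = 0" if "n \<notin> {..N}" for n
      using proj_G_above[OF N, of "s n"] s[of n] that by (simp add: h0)
    then show ?thesis by (intro summable_finite[of "{..N}"]) auto
  qed
  have add: "?f (u + v) n = ?f u n + ?f v n" for u v n
    using h QD by (simp add: linear_map_on_def linear_add[OF linear_proj_G])
  have scale: "?f (r *\<^sub>R v) n = r *\<^sub>R ?f v n" for r v n
    using h QD by (simp add: linear_map_on_def linear_cmul[OF linear_proj_G])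
  show ?thesis
    unfolding linear_map_on_def band_def add scale
    using sm subspace_D by (simp add: suminf_add suminf_scaleR_right)
qed

lemma band_G:
  assumes "linear_map_on D h" and "v \<in> G k"
  shows "inj s \<Longrightarrow> k = s m \<Longrightarrow> band h r s v = proj_G (r m) (h v)"
    and "k \<notin> range s \<Longrightarrow> band h r s v = 0"
proof -
  have h0: "proj_G n (h 0) = 0" for n
    by (simp add: linear_map_on_0[OF assms(1)] linear_0[OF linear_proj_G])
  show "band h r s v = proj_G (r m) (h v)" if "inj s" "k = s m"
  proof -
    have "band h r s v = (\<Sum>n\<in>{m}. proj_G (r n) (h (proj_G (s n) v)))"
      unfolding band_def
      by (rule suminf_finite) (use that assms(2) in \<open>auto simp: proj_G_G h0 inj_eq\<close>)
    then show ?thesis using that assms(2) by (simp add: proj_G_G)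
  qed
  show "band h r s v = 0" if "k \<notin> range s"
    unfolding band_def using that assms(2) by (subst suminf_finite[of "{}"]) (auto simp: proj_G_G h0)
qed

text \<open>
  The three bands of \<open>x i\<close> with offsets \<open>-1\<close>, \<open>0\<close> and \<open>1\<close> add up to \<open>x i\<close> in each degree, hence on the
  whole cyclic space.
\<close>

lemma apc_exists: "\<exists>t. is_apc_decomposition X \<phi> i t"
proof -
  let ?am = "band (x i) (\<lambda>n. n) Suc" and ?a0 = "band (x i) (\<lambda>n. n) (\<lambda>n. n)"
    and ?ap = "band (x i) Suc (\<lambda>n. n)"
  let ?op = "\<lambda>h v. if v \<in> D then Some (h v :: 'h) else None"
  have lin: "linear_map_on D ?am" "linear_map_on D ?a0" "linear_map_on D ?ap"
    by (simp_all add: linear_band linear_x)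
  have am: "?am v = (case n of 0 \<Rightarrow> 0 | Suc m \<Rightarrow> proj_G m (x i v))"
    and a0: "?a0 v = proj_G n (x i v)" and ap: "?ap v = proj_G (Suc n) (x i v)" if "v \<in> G n" for v n
  proof -
    show "?am v = (case n of 0 \<Rightarrow> 0 | Suc m \<Rightarrow> proj_G m (x i v))"
      using band_G[OF linear_x that, of Suc] by (cases n) auto
  qed (use band_G(1)[OF linear_x that, of "\<lambda>n. n" n] in auto)
  have op: "linear_operator (?op h) \<and> dom (?op h) = D" if "linear_map_on D h" for h
  proof -
    have "dom (?op h) = D" by (auto simp: dom_def)
    then show ?thesis
      using that unfolding linear_operator_def linear_map_on_def
      by (simp add: subspace_add subspace_scale)
  qed
  have "x i v = ?am v + ?a0 v + ?ap v" if "v \<in> D" for v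
  proof (rule linear_map_on_span_eq[OF linear_x[of i]])
    show "linear_map_on D (\<lambda>v. ?am v + ?a0 v + ?ap v)"
      using lin by (simp add: linear_map_on_def scaleR_add_right)
    show "v \<in> span (\<Union>n. G n)" using that by (simp add: D_eq_span_G)
    show "(\<Union>n. G n) \<subseteq> D" using G_subset_D by blast
    show "x i v = ?am v + ?a0 v + ?ap v" if "v \<in> (\<Union>n. G n)" for v
      using that x_G am a0 ap by auto
  qed
  moreover have "?am v \<in> G_space X \<phi> (k - 1) \<and> ?a0 v \<in> G_space X \<phi> k \<and> ?ap v \<in> G_space X \<phi> (k + 1)"
    if k: "0 \<le> k" and v: "v \<in> G_space X \<phi> k" for k v
  proof -
    obtain n where n: "k = int n" using k by (metis int_nat_eq)
    have "?am v \<in> G_space X \<phi> (k - 1)"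
    proof (cases n)
      case 0
      then show ?thesis using am[of v n] v n by (simp add: subspace_0[OF subspace_G])
    next
      case (Suc m)
      then show ?thesis using am[of v n] v n proj_G_in_G[of m] by simp
    qed
    moreover have "k + 1 = int (Suc n)" by (simp add: n)
    ultimately show ?thesis
      using a0[of v n] ap[of v n] v proj_G_in_G n by metis
  qed
  ultimately have "is_apc_decomposition X \<phi> i (?op ?am, ?op ?a0, ?op ?ap)"
    using op lin G_subset_D X_on_D unfolding is_apc_decomposition_def by (auto simp: subset_iff)
  then show ?thesis by blast
qed

lemma linear_map_on_operator:
  "linear_operator a \<Longrightarrow> dom a = D \<Longrightarrow> linear_map_on D (\<lambda>v. the (a v))"
  by (simp add: linear_operator_def linear_map_on_def)

lemma operator_eqI:
  assumes "linear_operator a" "dom a = D" "linear_operator b" "dom b = D"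
    and "\<And>n v. v \<in> G n \<Longrightarrow> the (a v) = the (b v)"
  shows "a = b"
proof
  fix v
  show "a v = b v"
  proof (cases "v \<in> D")
    case True
    have "the (a v) = the (b v)"
    proof (rule linear_map_on_span_eq[where h = "\<lambda>v. the (a v)" and k = "\<lambda>v. the (b v)"])
      show "linear_map_on D (\<lambda>v. the (a v))" "linear_map_on D (\<lambda>v. the (b v))"
        using assms(1-4) by (simp_all add: linear_map_on_operator)
      show "v \<in> span (\<Union>n. G n)" using True by (simp add: D_eq_span_G)
    qed (use assms(5) G_subset_D in auto)
    moreover obtain y z where "a v = Some y" "b v = Some z"
      using True assms(2,4) by (metis domD)
    ultimately show ?thesis by simp
  next
    case False
    then show ?thesis using assms(2,4) by (metis domIff)
  qed
qed

lemma apc_unique: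
  assumes "is_apc_decomposition X \<phi> i t" and "is_apc_decomposition X \<phi> i t'"
  shows "t = t'"
proof -
  obtain a b e a' b' e' where t: "t = (a, b, e)" "t' = (a', b', e')"
    by (metis prod_cases3)
  note T = assms[unfolded t is_apc_decomposition_def prod.case]
  have "the (a v) = the (a' v) \<and> the (b v) = the (b' v) \<and> the (e v) = the (e' v)" if v: "v \<in> G n" for n v
  proof -
    have "v \<in> D" using v G_subset_D by blast
    then have eq: "the (a v) + the (b v) + the (e v) = the (a' v) + the (b' v) + the (e' v)"
      using T by (metis option.inject)
    have n: "0 \<le> int n" by simp
    show ?thesis
      using G_components_unique[OF _ _ _ _ _ _ eq, of "int n"] T v n by metis
  qed
  then show ?thesis
    using T unfolding t by (auto intro!: operator_eqI)
qed

lemma apc_decomposition: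
  "is_apc_decomposition X \<phi> i (annihilation X \<phi> i, preservation X \<phi> i, creation X \<phi> i)"
  unfolding annihilation_def preservation_def creation_def prod.collapse apc_decomposition_def
  using apc_exists apc_unique by (metis theI)

definition am where "am i v = the (annihilation X \<phi> i v)"
definition a0 where "a0 i v = the (preservation X \<phi> i v)"
definition ap where "ap i v = the (creation X \<phi> i v)"

lemma linear_apc: "linear_map_on D (am i)" "linear_map_on D (a0 i)" "linear_map_on D (ap i)"
  using apc_decomposition[of i] linear_map_on_operator
  unfolding is_apc_decomposition_def am_def a0_def ap_def by simp_all

lemma apc_on_D:
  assumes "v \<in> D"
  shows "annihilation X \<phi> i v = Some (am i v)" "preservation X \<phi> i v = Some (a0 i v)"
    "creation X \<phi> i v = Some (ap i v)"
  using apc_decomposition[of i] assms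
  unfolding is_apc_decomposition_def am_def a0_def ap_def
  by (simp_all add: domIff set_eq_iff option.expand)

lemma x_apc: "v \<in> D \<Longrightarrow> x i v = am i v + a0 i v + ap i v"
  using apc_decomposition[of i]
  unfolding is_apc_decomposition_def am_def a0_def ap_def x_def by simp

lemma apc_int_G:
  assumes "0 \<le> k" "v \<in> G_space X \<phi> k"
  shows "am i v \<in> G_space X \<phi> (k - 1)" "a0 i v \<in> G_space X \<phi> k" "ap i v \<in> G_space X \<phi> (k + 1)"
  using apc_decomposition[of i] assms
  unfolding is_apc_decomposition_def am_def a0_def ap_def by simp_all

lemma am_G_0: "v \<in> G 0 \<Longrightarrow> am i v = 0"
  using apc_int_G(1)[of 0 v i] by (simp add: G_neg)

lemma am_G_Suc: "v \<in> G (Suc n) \<Longrightarrow> am i v \<in> G n"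
  using apc_int_G(1)[of "int (Suc n)" v i] by simp

lemma a0_G: "v \<in> G n \<Longrightarrow> a0 i v \<in> G n"
  by (rule apc_int_G) simp

lemma ap_G: "v \<in> G n \<Longrightarrow> ap i v \<in> G (Suc n)"
  using apc_int_G(3)[of "int n" v i] by (simp add: add.commute)

lemma apc_D:
  assumes "v \<in> D" shows "am i v \<in> D" "a0 i v \<in> D" "ap i v \<in> D"
proof -
  have v: "v \<in> span (\<Union>n. G n)"
    using assms by (simp only: D_eq_span_G)
  have G: "(\<Union>n. G n) \<subseteq> D"
    by (intro UN_least G_subset_D)
  have gen: "am i u \<in> D \<and> a0 i u \<in> D \<and> ap i u \<in> D" if u: "u \<in> (\<Union>n. G n)" for u
  proof -
    obtain n where n: "u \<in> G n" using u by (rule UN_E)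
    show ?thesis
      using apc_int_G[OF of_nat_0_le_iff n, of i] subsetD[OF G_subset_D] by blast
  qed
  show "am i v \<in> D" by (rule linear_map_on_span[OF linear_apc(1) G subspace_D _ v]) (use gen in blast)
  show "a0 i v \<in> D" by (rule linear_map_on_span[OF linear_apc(2) G subspace_D _ v]) (use gen in blast)
  show "ap i v \<in> D" by (rule linear_map_on_span[OF linear_apc(3) G subspace_D _ v]) (use gen in blast)
qed

lemma vacuum_in_G: "\<phi> \<in> G 0"
  using vacuum_in_F[of 0] by (simp add: G_0[simplified])

lemma vacuum_in_D: "\<phi> \<in> D"
  using vacuum_in_F F_subset_D by blast

lemma vacuum_inner: "\<phi> \<bullet> \<phi> = 1"
  using prob by (simp add: nc_probability_space_def dot_square_norm)

section \<open>The commutation relations determine the moments\<close>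

text \<open>
  Vectors of degree at most \<open>n + 1\<close> arise from the vacuum and from vectors \<open>x i u\<close> with \<open>u \<in> F n\<close>.
  By symmetry the scalar product of \<open>v\<close> with \<open>x i u\<close> is that of \<open>x i v\<close> with \<open>u\<close>, to which only the
  annihilation part of \<open>x i v\<close> can contribute. So \<open>v\<close> is orthogonal to a space that contains it.
\<close>

lemma annihilated_imp_zero:
  assumes v: "v \<in> G (Suc n)" and zero: "\<And>i. am i v = 0"
  shows "v = 0"
proof -
  have vD: "v \<in> D" using v G_subset_D by blast
  have step: "v \<bullet> x i u = 0" if u: "u \<in> F n" for i u
  proof -
    have "u \<bullet> a0 i v = 0" "u \<bullet> ap i v = 0"
      using F_orthogonal_G[OF u a0_G[OF v]] F_orthogonal_G[OF u ap_G[OF v]] by simp_all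
    then have "x i v \<bullet> u = 0"
      by (simp add: x_apc[OF vD] zero inner_add_right inner_commute[of _ u])
    then show ?thesis using symmetric_x[OF vD, of u i] u F_subset_D by auto
  qed
  have "v \<bullet> word_vector w = 0" if "length w \<le> Suc n" for w
  proof (cases w)
    case Nil
    then show ?thesis using F_orthogonal_G[OF vacuum_in_F[of 0] v] by (simp add: inner_commute)
  next
    case (Cons i w')
    then show ?thesis using that step[OF word_vector_in_F, of w' i] by (simp add: x_word_vector)
  qed
  moreover have "v \<in> span (word_vector ` {w. length w \<le> Suc n})"
    using v G_subset_F by (auto simp flip: F_eq simp del: of_nat_Suc)
  moreover have "linear_map_on UNIV (\<lambda>u. v \<bullet> u)"
    by (simp add: linear_map_on_def inner_add_right)
  ultimately have "v \<bullet> v \<in> {0}"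
    using linear_map_on_span[of UNIV "\<lambda>u. v \<bullet> u" "word_vector ` {w. length w \<le> Suc n}" "{0}" v] by auto
  then show ?thesis by simp
qed

text \<open>
  The products of creation operators applied to the vacuum satisfy the moment recursion.
\<close>

theorem moments_if_commutation:
  assumes C1: "\<And>i j v. v \<in> D \<Longrightarrow> am i (ap j v) - q *\<^sub>R ap j (am i v) = c i j *\<^sub>R v"
    and C2: "\<And>i j v. v \<in> D \<Longrightarrow> am i (a0 j v) - q *\<^sub>R a0 j (am i v) = 0"
    and C3: "\<And>i. x i \<phi> \<bullet> \<phi> = 0"
  shows "word_vector w \<bullet> \<phi> = wick_moment q c (rev w) []"
proof -
  have a0_G_0: "a0 j v = 0" if "v \<in> G n" for j v n
    using that
  proof (induction n arbitrary: v)
    case 0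
    have "a0 j \<phi> \<in> span {\<phi>}"
      using a0_G[OF vacuum_in_G, of j] by (simp add: G_0[simplified] F_eq)
    then obtain r where r: "a0 j \<phi> = r *\<^sub>R \<phi>"
      by (auto simp: span_singleton)
    have "ap j \<phi> \<bullet> \<phi> = 0"
      using F_orthogonal_G[OF vacuum_in_F ap_G[OF vacuum_in_G], of 0 j] by (simp add: inner_commute)
    then have "r = 0"
      using C3[of j] by (simp add: x_apc[OF vacuum_in_D] am_G_0[OF vacuum_in_G] inner_add_left r vacuum_inner)
    then have "a0 j \<phi> = 0" using r by simp
    moreover have "v \<in> span {\<phi>}" using 0 by (simp add: G_0[simplified] F_eq)
    ultimately have "a0 j v \<in> {0}"
      using vacuum_in_D linear_map_on_span[OF linear_apc(2)[of j], of "{\<phi>}" "{0}" v] by auto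
    then show ?case by simp
  next
    case (Suc n)
    \<comment> \<open>By the induction hypothesis \<open>a0 j\<close> vanishes at \<open>am i v\<close>, which has lower degree.\<close>
    have "am i (a0 j v) = 0" for i
      using C2[of v i j] Suc.IH[OF am_G_Suc[OF Suc.prems], of i] Suc.prems G_subset_D by auto
    then show ?case by (rule annihilated_imp_zero[OF a0_G[OF Suc.prems]])
  qed
  have a0: "a0 j v = 0" if "v \<in> D" for j v
  proof -
    have "a0 j v \<in> {0}"
      by (rule linear_map_on_span[OF linear_apc(2), where S = "\<Union>n. G n"])
        (use that a0_G_0 in \<open>auto simp: UN_least[OF G_subset_D] simp flip: D_eq_span_G\<close>)
    then show ?thesis by simp
  qed
  define \<psi> where "\<psi> u = foldr ap u \<phi>" for u
  have \<psi>_simps: "\<psi> [] = \<phi>" "\<psi> (i # u) = ap i (\<psi> u)" for i u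
    by (simp_all add: \<psi>_def)
  have \<psi>_G: "\<psi> u \<in> G (length u)" for u
    by (induction u) (use ap_G vacuum_in_G in \<open>auto simp: \<psi>_simps simp del: of_nat_Suc\<close>)
  then have \<psi>_D: "\<psi> u \<in> D" for u
    using G_subset_D by blast
  have am_\<psi>: "am i (\<psi> u) = contraction q (c i) \<psi> u" for i u
  proof (induction u)
    case Nil
    then show ?case by (simp add: \<psi>_simps am_G_0[OF vacuum_in_G])
  next
    case (Cons j u)
    have "am i (\<psi> (j # u)) = c i j *\<^sub>R \<psi> u + q *\<^sub>R ap j (am i (\<psi> u))"
      using C1[OF \<psi>_D, of i j u] by (simp add: \<psi>_simps algebra_simps)
    also have "ap j (am i (\<psi> u)) = contraction q (c i) (\<lambda>v. ap j (\<psi> v)) u"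
      unfolding Cons.IH by (rule linear_map_on_contraction[OF linear_apc(3)]) (rule \<psi>_D)
    finally show ?case by (simp add: contraction_Cons \<psi>_simps)
  qed
  have "x i (\<psi> u) = \<psi> (i # u) + contraction q (c i) \<psi> u" for i u
    by (simp add: x_apc[OF \<psi>_D] a0[OF \<psi>_D] am_\<psi> \<psi>_simps)
  moreover have "\<psi> u \<bullet> \<phi> = of_bool (u = [])" for u
  proof (cases u)
    case Nil
    then show ?thesis by (simp add: \<psi>_simps vacuum_inner)
  next
    case (Cons i v)
    then show ?thesis
      using F_orthogonal_G[OF vacuum_in_F[of 0] \<psi>_G[of u]] by (simp add: inner_commute)
  qed
  moreover have "linear_map_on D (\<lambda>v. v \<bullet> \<phi>)"
    using subspace_D by (simp add: linear_map_on_def inner_add_left)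
  ultimately have "foldr x (rev (rev w)) (\<psi> []) \<bullet> \<phi> = of_real (wick_moment q c (rev w) [])"
    by (intro wick_moment_unique[OF subspace_D linear_x x_D, where E = "\<lambda>v. v \<bullet> \<phi>"]) (auto simp: \<psi>_D)
  then show ?thesis by (simp add: word_vector_eq_foldr \<psi>_simps)
qed

section \<open>The moments determine the commutation relations\<close>

text \<open>
  The q-Wick products, obtained by solving the moment recursion for its leading vector.
\<close>

context
  fixes q :: real and c :: "'n \<Rightarrow> 'n \<Rightarrow> real"
begin

fun wick :: "'n list \<Rightarrow> 'h" where
  "wick [] = \<phi>"
| "wick (i # u) = x i (wick u) - contraction q (c i) wick u"

end

lemma x_wick: "x i (wick q c u) = wick q c (i # u) + contraction q (c i) (wick q c) u"
  by simp

\<comment> \<open>As a rewrite rule, this equation would undo \<open>x_wick\<close>.\<close>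
declare wick.simps(2) [simp del]

lemma wick_in_F: "wick q c u \<in> F (length u)"
proof (induction "length u" arbitrary: u rule: less_induct)
  case less
  show ?case
  proof (cases u)
    case Nil
    then show ?thesis by (simp add: vacuum_in_F)
  next
    case (Cons i v)
    have "contraction q (c i) (wick q c) v \<in> F (length u)"
    proof (rule contraction_in_subspace[OF subspace_F])
      fix y :: "'n list" assume "Suc (length y) = length v"
      then show "wick q c y \<in> F (length u)"
        using less[of y] F_mono[of "length y" "length u"] Cons by auto
    qed
    moreover have "x i (wick q c v) \<in> F (length u)"
      using x_F less[of v] Cons by simp
    ultimately show ?thesis
      unfolding Cons wick.simps by (intro subspace_diff subspace_F) (use Cons in auto)
  qed
qed

lemma wick_in_D: "wick q c u \<in> D"
  using wick_in_F F_subset_D by blast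

lemma D_eq_span_wick: "D = span (range (wick q c))"
proof
  have "word_vector w \<in> span (range (wick q c))" for w
  proof (induction w)
    case Nil
    then show ?case by (metis word_vector_Nil wick.simps(1) rangeI span_base)
  next
    case (Cons i w)
    have "x i (wick q c u) \<in> span (range (wick q c))" for u
      unfolding x_wick by (intro span_add contraction_in_subspace subspace_span span_base rangeI)
    then have "x i (word_vector w) \<in> span (range (wick q c))"
      using linear_map_on_span[OF linear_x _ subspace_span _ Cons.IH] wick_in_D by blast
    then show ?case by (simp add: x_word_vector)
  qed
  then show "D \<subseteq> span (range (wick q c))"
    unfolding D_eq by (intro span_minimal subspace_span) auto
  show "span (range (wick q c)) \<subseteq> D"
    using wick_in_D subspace_D by (intro span_minimal) auto
qed

text \<open>
  Once the q-Wick product of a word is known to have degree exactly the length of the word, its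
  recursion displays the three homogeneous components of \<open>x i\<close> applied to it.
\<close>

theorem commutation_if_moments:
  assumes mom: "\<And>w. word_vector w \<bullet> \<phi> = wick_moment q c (rev w) []"
  shows "v \<in> D \<Longrightarrow> am i (ap j v) - q *\<^sub>R ap j (am i v) = c i j *\<^sub>R v"
    and "v \<in> D \<Longrightarrow> am i (a0 j v) - q *\<^sub>R a0 j (am i v) = 0"
    and "x i \<phi> \<bullet> \<phi> = 0"
proof -
  have lin: "linear_map_on D (foldr x w)" and inD: "v \<in> D \<Longrightarrow> foldr x w v \<in> D" for w v
    using linear_map_on_foldr[where x = x, OF subspace_D linear_x x_D] by blast+
  have lin_phi: "linear_map_on D (\<lambda>v. foldr x w v \<bullet> \<phi>)" for w
    using lin by (simp add: linear_map_on_def inner_add_left)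
  let ?\<psi> = "wick q c"
  have wick_mom: "foldr x (rev w) (?\<psi> u) \<bullet> \<phi> = wick_moment q c w u" for u w
  proof (induction "length u" arbitrary: u w rule: less_induct)
    case less
    show ?case
    proof (cases u)
      case Nil
      then show ?thesis using mom[of "rev w"] by (simp add: word_vector_eq_foldr)
    next
      case (Cons i v)
      have con: "contraction q (c i) ?\<psi> v \<in> D"
        by (rule contraction_in_subspace[OF subspace_D]) (rule wick_in_D)
      have "foldr x (rev w) (?\<psi> u) \<bullet> \<phi> + foldr x (rev w) (contraction q (c i) ?\<psi> v) \<bullet> \<phi> =
          foldr x (rev w) (x i (?\<psi> v)) \<bullet> \<phi>"
        unfolding x_wick Cons using lin_phi[of "rev w"] con wick_in_D by (simp add: linear_map_on_def)
      also have "\<dots> = wick_moment q c (i # w) v"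
        using less[of v "i # w"] Cons by simp
      also have "foldr x (rev w) (contraction q (c i) ?\<psi> v) \<bullet> \<phi> =
          contraction q (c i) (\<lambda>y. foldr x (rev w) (?\<psi> y) \<bullet> \<phi>) v"
        by (rule linear_map_on_contraction[OF lin_phi]) (rule wick_in_D)
      also have "\<dots> = contraction q (c i) (wick_moment q c w) v"
        by (rule contraction_cong[OF refl]) (use less Cons in auto)
      finally show ?thesis by (simp add: Cons)
    qed
  qed
  have adj: "word_vector w \<bullet> v = foldr x (rev w) v \<bullet> \<phi>" if "v \<in> D" for w v
    using that
  proof (induction w arbitrary: v)
    case Nil
    then show ?case by (simp add: inner_commute)
  next
    case (Cons i w)
    have "word_vector w \<in> D" using F_subset_D word_vector_in_F by blast
    then have "word_vector (i # w) \<bullet> v = word_vector w \<bullet> x i v"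
      using symmetric_x[of "word_vector w" v i] Cons.prems by (simp flip: x_word_vector)
    then show ?case using Cons.IH[OF x_D[OF Cons.prems]] by simp
  qed
  have \<psi>_G: "?\<psi> u \<in> G (length u)" for u
  proof (cases u)
    case Nil
    then show ?thesis using vacuum_in_G by simp
  next
    case (Cons i v)
    \<comment> \<open>\<open>F (length v)\<close> is spanned by words shorter than \<open>u\<close>, whose moments against \<open>?\<psi> u\<close> vanish.\<close>
    have "y \<bullet> ?\<psi> u = 0" if y: "y \<in> F (length v)" for y
    proof -
      have "word_vector w \<bullet> ?\<psi> u = 0" if "length w \<le> length v" for w
        using that Cons by (simp add: adj[OF wick_in_D] wick_mom wick_moment_eq_0)
      moreover have "linear_map_on UNIV (\<lambda>y. y \<bullet> ?\<psi> u)"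
        by (simp add: linear_map_on_def inner_add_left)
      ultimately have "y \<bullet> ?\<psi> u \<in> {0}"
        using y linear_map_on_span[of UNIV "\<lambda>y. y \<bullet> ?\<psi> u" "word_vector ` {w. length w \<le> length v}" "{0}" y]
        unfolding F_eq by auto
      then show ?thesis by simp
    qed
    then show ?thesis
      using wick_in_F[of q c u] Cons by (simp add: G_Suc del: of_nat_Suc)
  qed
  have apc: "am i (?\<psi> u) = contraction q (c i) ?\<psi> u" "a0 i (?\<psi> u) = 0" "ap i (?\<psi> u) = ?\<psi> (i # u)" for i u
  proof -
    have con: "contraction q (c i) ?\<psi> u \<in> G_space X \<phi> (int (length u) - 1)"
    proof (rule contraction_in_subspace[OF subspace_G])
      fix y :: "'n list" assume "Suc (length y) = length u"
      then have "int (length y) = int (length u) - 1" by simp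
      then show "?\<psi> y \<in> G_space X \<phi> (int (length u) - 1)" using \<psi>_G[of y] by simp
    qed
    have suc: "?\<psi> (i # u) \<in> G_space X \<phi> (int (length u) + 1)"
      using \<psi>_G[of "i # u"] by (simp add: add.commute)
    have "am i (?\<psi> u) + a0 i (?\<psi> u) + ap i (?\<psi> u) = contraction q (c i) ?\<psi> u + 0 + ?\<psi> (i # u)"
      using x_apc[OF wick_in_D, of i q c u] by (simp add: x_wick add.commute)
    note * = G_components_unique[OF apc_int_G(1) con apc_int_G(2) subspace_0[OF subspace_G] apc_int_G(3) suc this]
    show "am i (?\<psi> u) = contraction q (c i) ?\<psi> u" "a0 i (?\<psi> u) = 0" "ap i (?\<psi> u) = ?\<psi> (i # u)"
      by (rule *; simp add: \<psi>_G)+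
  qed
  show "am i (ap j v) - q *\<^sub>R ap j (am i v) = c i j *\<^sub>R v" if v: "v \<in> D"
  proof (rule linear_map_on_span_eq[where D = D and S = "range ?\<psi>" and v = v
        and h = "\<lambda>v. am i (ap j v) - q *\<^sub>R ap j (am i v)" and k = "\<lambda>v. c i j *\<^sub>R v"])
    show "linear_map_on D (\<lambda>v. am i (ap j v) - q *\<^sub>R ap j (am i v))"
      by (intro linear_map_on_diff linear_map_on_scale linear_map_on_compose[OF linear_apc(1,3)]
          linear_map_on_compose[OF linear_apc(3,1)] apc_D)
    show "linear_map_on D (\<lambda>v. c i j *\<^sub>R v)"
      using subspace_D by (simp add: linear_map_on_def scaleR_add_right)
    show "am i (ap j s) - q *\<^sub>R ap j (am i s) = c i j *\<^sub>R s" if "s \<in> range ?\<psi>" for s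
    proof -
      obtain u where s: "s = ?\<psi> u" using \<open>s \<in> range ?\<psi>\<close> by blast
      have "ap j (contraction q (c i) ?\<psi> u) = contraction q (c i) (\<lambda>y. ?\<psi> (j # y)) u"
        by (subst linear_map_on_contraction[OF linear_apc(3)]) (simp_all add: wick_in_D apc)
      then show ?thesis by (simp add: s apc contraction_Cons)
    qed
    show "range ?\<psi> \<subseteq> D"
      using wick_in_D by blast
    show "v \<in> span (range ?\<psi>)"
      using v by (simp only: D_eq_span_wick[of q c])
  qed
  have a0: "a0 i v = 0" if v: "v \<in> D" for i v
  proof -
    have "v \<in> span (range ?\<psi>)"
      using v by (simp only: D_eq_span_wick[of q c])
    moreover have "range ?\<psi> \<subseteq> D"
      using wick_in_D by blast
    moreover have "a0 i s \<in> {0}" if "s \<in> range ?\<psi>" for s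
      using that by (auto simp: apc)
    ultimately have "a0 i v \<in> {0}"
      using linear_map_on_span[OF linear_apc(2)[of i] _ subspace_single_0] by blast
    then show ?thesis by simp
  qed
  show "am i (a0 j v) - q *\<^sub>R a0 j (am i v) = 0" if "v \<in> D"
    using that by (simp add: a0 apc_D linear_map_on_0[OF linear_apc(1)])
  show "x i \<phi> \<bullet> \<phi> = 0"
    using mom[of "[i]"] x_word_vector[of i "[]"] by simp
qed

text \<open>
  Equality of moments need only be tested on monomials; polynomials follow by linearity.
\<close>

lemma moment_equal_iff:
  fixes f :: "'n \<Rightarrow> 'k::{real_inner, complete_space}"
  assumes "\<And>i j. f i \<bullet> f j = c i j"
  shows "moment_equal (\<lambda>g. complex_of_real (expectation \<phi> g)) X (q_expectation q) (\<lambda>i. q_gaussian q (f i))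
    \<longleftrightarrow> (\<forall>w. word_vector w \<bullet> \<phi> = wick_moment q c (rev w) [])"
proof -
  have eq: "expectation \<phi> (nc_eval p X) =
      (\<Sum>w\<in>Poly_Mapping.keys p. Poly_Mapping.lookup p w * (word_vector w \<bullet> \<phi>))" for p
    by (simp add: expectation_def nc_eval_vacuum inner_sum_left)
  have "moment_equal (\<lambda>g. complex_of_real (expectation \<phi> g)) X (q_expectation q) (\<lambda>i. q_gaussian q (f i))
    \<longleftrightarrow> (\<forall>p. (\<Sum>w\<in>Poly_Mapping.keys p. Poly_Mapping.lookup p w * (word_vector w \<bullet> \<phi>)) =
      (\<Sum>w\<in>Poly_Mapping.keys p. Poly_Mapping.lookup p w * wick_moment q c (rev w) []))"
    unfolding moment_equal_def q_expectation_nc_eval[OF assms] eq of_real_eq_iff ..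
  also have "\<dots> \<longleftrightarrow> (\<forall>w. word_vector w \<bullet> \<phi> = wick_moment q c (rev w) [])"
  proof
    assume H: "\<forall>p. (\<Sum>w\<in>Poly_Mapping.keys p. Poly_Mapping.lookup p w * (word_vector w \<bullet> \<phi>)) =
      (\<Sum>w\<in>Poly_Mapping.keys p. Poly_Mapping.lookup p w * wick_moment q c (rev w) [])"
    show "\<forall>w. word_vector w \<bullet> \<phi> = wick_moment q c (rev w) []"
    proof
      fix w show "word_vector w \<bullet> \<phi> = wick_moment q c (rev w) []"
        using H[rule_format, of "Poly_Mapping.single w 1"] by simp
    qed
  qed simp
  finally show ?thesis .
qed

lemma conditions_iff:
  "((\<forall>v\<in>D. q_commutator q (annihilation X \<phi> i) (creation X \<phi> j) v = Some (r *\<^sub>R v)) \<and>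
    (\<forall>v\<in>D. q_commutator q (annihilation X \<phi> i) (preservation X \<phi> j) v = Some 0) \<and>
    expectation \<phi> (X i) = 0) \<longleftrightarrow>
   (\<forall>v\<in>D. am i (ap j v) - q *\<^sub>R ap j (am i v) = r *\<^sub>R v) \<and>
   (\<forall>v\<in>D. am i (a0 j v) - q *\<^sub>R a0 j (am i v) = 0) \<and> x i \<phi> \<bullet> \<phi> = 0"
proof -
  have "q_commutator q (annihilation X \<phi> i) (creation X \<phi> j) v = Some (am i (ap j v) - q *\<^sub>R ap j (am i v))"
    "q_commutator q (annihilation X \<phi> i) (preservation X \<phi> j) v = Some (am i (a0 j v) - q *\<^sub>R a0 j (am i v))"
    if "v \<in> D" for v
    using that by (simp_all add: q_commutator_def apc_on_D apc_D)
  then show ?thesis by (simp add: expectation_def x_def)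
qed

end

section \<open>Characterization of q-Gaussian random variables\<close>

theorem corollary4p7:
  fixes q :: real
    and c :: "real ^ 'n ^ 'n"
    and X :: "'n::finite \<Rightarrow> 'h::{real_inner, complete_space} operator"
    and \<phi> :: 'h
  assumes "-1 \<le> q" and "q \<le> 1"
    and "positive_definite c"
    and "nc_probability_space X \<phi>"
  shows "(\<exists>f :: 'n \<Rightarrow> real ^ 'n. \<forall>i j. f i \<bullet> f j = c $ i $ j) \<and>
    (\<forall>f :: 'n \<Rightarrow> 'k::{real_inner, complete_space}.
      (\<forall>i j. f i \<bullet> f j = c $ i $ j) \<longrightarrow>
      ((\<forall>i j.
          (\<forall>v\<in>cyclic_space X \<phi>.
             q_commutator q (annihilation X \<phi> i) (creation X \<phi> j) v = Some (c $ i $ j *\<^sub>R v)) \<and>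
          (\<forall>v\<in>cyclic_space X \<phi>.
             q_commutator q (annihilation X \<phi> i) (preservation X \<phi> j) v = Some 0) \<and>
          expectation \<phi> (X i) = 0)
       \<longleftrightarrow>
       moment_equal (\<lambda>g. complex_of_real (expectation \<phi> g)) X
         (q_expectation q) (\<lambda>i. q_gaussian q (f i))))"
proof (intro conjI allI impI)
  show "\<exists>f :: 'n \<Rightarrow> real ^ 'n. \<forall>i j. f i \<bullet> f j = c $ i $ j"
    using assms(3) by (rule positive_definite_gram)
next
  interpret vacuum_space X \<phi>
    by unfold_locales (rule assms(4))
  fix f :: "'n \<Rightarrow> 'k"
  assume f: "\<forall>i j. f i \<bullet> f j = c $ i $ j"
  let ?c = "\<lambda>i j. c $ i $ j"
  have moments: "moment_equal (\<lambda>g. complex_of_real (expectation \<phi> g)) X (q_expectation q) (\<lambda>i. q_gaussian q (f i))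
    \<longleftrightarrow> (\<forall>w. word_vector w \<bullet> \<phi> = wick_moment q ?c (rev w) [])"
    by (rule moment_equal_iff) (use f in simp)
  show "(\<forall>i j.
          (\<forall>v\<in>cyclic_space X \<phi>.
             q_commutator q (annihilation X \<phi> i) (creation X \<phi> j) v = Some (c $ i $ j *\<^sub>R v)) \<and>
          (\<forall>v\<in>cyclic_space X \<phi>.
             q_commutator q (annihilation X \<phi> i) (preservation X \<phi> j) v = Some 0) \<and>
          expectation \<phi> (X i) = 0)
       \<longleftrightarrow>
       moment_equal (\<lambda>g. complex_of_real (expectation \<phi> g)) X
         (q_expectation q) (\<lambda>i. q_gaussian q (f i))"
    unfolding conditions_iff moments
  proof
    assume "\<forall>i j. (\<forall>v\<in>D. am i (ap j v) - q *\<^sub>R ap j (am i v) = c $ i $ j *\<^sub>R v) \<and>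
      (\<forall>v\<in>D. am i (a0 j v) - q *\<^sub>R a0 j (am i v) = 0) \<and> x i \<phi> \<bullet> \<phi> = 0"
    then show "\<forall>w. word_vector w \<bullet> \<phi> = wick_moment q ?c (rev w) []"
      by (intro allI moments_if_commutation) simp_all
  next
    assume "\<forall>w. word_vector w \<bullet> \<phi> = wick_moment q ?c (rev w) []"
    then have mom: "\<And>w. word_vector w \<bullet> \<phi> = wick_moment q ?c (rev w) []"
      by simp
    show "\<forall>i j. (\<forall>v\<in>D. am i (ap j v) - q *\<^sub>R ap j (am i v) = c $ i $ j *\<^sub>R v) \<and>
      (\<forall>v\<in>D. am i (a0 j v) - q *\<^sub>R a0 j (am i v) = 0) \<and> x i \<phi> \<bullet> \<phi> = 0"
      using commutation_if_moments[OF mom] by simp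
  qed
qed

end
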